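(* For $n\in\mathbb{N}$ (so $n\ge 1$), let $$\mathcal{S}_n=\mathbb{C}\setminus\{z\in\mathbb{C}:|z|\ge 1\text{ and }\operatorname{Arg} z^n=0\},$$ and let $\tau_{\mathcal{S}_n}$ be the exit time from $\mathcal{S}_n$ of standard planar Brownian motion $\mathbf{W}$ started at the origin. Then $$\mathbb{E}\left[\tau_{\mathcal{S}_n}\right]=\begin{cases}\infty, & n\le 4,\\[4pt] \dfrac{\Gamma\left(\frac12-\frac2n\right)}{2\sqrt{\pi}\,\Gamma\left(1-\frac2n\right)}, & n>4.\end{cases}$$
   Context: Standard planar Brownian motion is $\mathbf{W}(t)=(W_1(t),W_2(t))$ with $W_1,W_2$ independent one-dimensional standard Brownian motions started at $0$; $\mathbb{R}^2$ is identified with $\mathbb{C}$. $\operatorname{Arg}$ is the principal argument, so $\mathcal{S}_n$ is the plane with $n$ equally spaced radial slits, going from the unit circle to infinity, removed. The exit time is $\tau_{\mathcal{S}_n}=\inf\{t\ge 0:\mathbf{W}(t)\notin\mathcal{S}_n\}$. *)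

theory Defs
  imports "HOL-Probability.Probability" "HOL-Analysis.Analysis"
begin

definition standard_brownian_motion :: "'a measure \<Rightarrow> (real \<Rightarrow> 'a \<Rightarrow> real) \<Rightarrow> bool" where
  "standard_brownian_motion M B \<longleftrightarrow>
     prob_space M \<and>
     (\<forall>t\<ge>0. B t \<in> borel_measurable M) \<and>
     (AE \<omega> in M. B 0 \<omega> = 0) \<and>
     (\<forall>(k::nat) (t::nat \<Rightarrow> real). 0 \<le> t 0 \<longrightarrow> (\<forall>i<k. t i \<le> t (Suc i)) \<longrightarrow>
        prob_space.indep_vars M (\<lambda>_. borel) (\<lambda>i \<omega>. B (t (Suc i)) \<omega> - B (t i) \<omega>) {..<k}) \<and>
     (\<forall>s t. 0 \<le> s \<longrightarrow> s < t \<longrightarrow>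
        distributed M lborel (\<lambda>\<omega>. B t \<omega> - B s \<omega>) (normal_density 0 (sqrt (t - s)))) \<and>
     (AE \<omega> in M. continuous_on {0..} (\<lambda>t. B t \<omega>))"

text \<open>The two coordinates are independent as processes, that is, as random elements of the
  product space of all functions on the time axis.\<close>

definition planar_brownian_motion :: "'a measure \<Rightarrow> (real \<Rightarrow> 'a \<Rightarrow> complex) \<Rightarrow> bool" where
  "planar_brownian_motion M W \<longleftrightarrow>
     standard_brownian_motion M (\<lambda>t \<omega>. Re (W t \<omega>)) \<and>
     standard_brownian_motion M (\<lambda>t \<omega>. Im (W t \<omega>)) \<and>
     prob_space.indep_var M
       (PiM {0..} (\<lambda>_. borel)) (\<lambda>\<omega>. \<lambda>t\<in>{0..}. Re (W t \<omega>))
       (PiM {0..} (\<lambda>_. borel)) (\<lambda>\<omega>. \<lambda>t\<in>{0..}. Im (W t \<omega>))"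

text \<open>The exit time is extended-valued: it is \<open>\<infinity>\<close> on paths that never leave the set.\<close>

definition exit_time :: "(real \<Rightarrow> 'a \<Rightarrow> complex) \<Rightarrow> complex set \<Rightarrow> 'a \<Rightarrow> ennreal" where
  "exit_time W S \<omega> = (INF t\<in>{t. 0 \<le> t \<and> W t \<omega> \<notin> S}. ennreal t)"

definition slit_plane :: "nat \<Rightarrow> complex set" where
  "slit_plane n = - {z. 1 \<le> cmod z \<and> Arg (z ^ n) = 0}"

end

theory Submission
  imports Defs "HOL-Complex_Analysis.Complex_Analysis" "HOL-Real_Asymp.Real_Asymp"
begin

text \<open>Let \<open>g\<close> be the conformal map of the slit plane onto the unit disc, \<open>T\<close> the first time at which
  \<open>|g\<^sup>n| = r < 1\<close>, and \<open>Y\<close> the value of \<open>g\<^sup>n\<close> at \<open>W(T)\<close>. Optional stopping gives \<open>E |W(T)|\<^sup>2 = 2 E T\<close> and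
  \<open>E Y\<^sup>k = 0\<close> for \<open>k \<ge> 1\<close>. Since \<open>|W(T)|\<^sup>2 = (4 r)\<^sup>a / |1 + Y|\<^bsup>2a\<^esup>\<close> with \<open>a = 2 / n\<close>, expanding
  \<open>(1 + Y)\<^bsup>-a\<^esup>\<close> with coefficients \<open>b\<^sub>k\<close> yields \<open>2 E T = (4 r)\<^sup>a (\<Sum>k. b\<^sub>k\<^sup>2 r\<^bsup>2k\<^esup>)\<close>. As \<open>r\<close> tends to 1
  the times \<open>T\<close> increase to the exit time; Gauss's summation and the duplication formula then give the
  value, and the series diverges for \<open>a \<ge> 1 / 2\<close>.

  Optional stopping is proved without stochastic calculus: on the grid of mesh \<open>h\<close> the motion is a
  random walk, one step changes the expectation of \<open>|x|\<^sup>2\<close> and of a holomorphic function by \<open>2 h\<close> and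
  \<open>0\<close> up to \<open>O(h\<^sup>2)\<close>, and the expected number of steps is \<open>O(1 / h)\<close>.\<close>

section \<open>The disc map of the slit plane\<close>

text \<open>The equation \<open>x ^ n = 4 * Y / (1 + Y)\<^sup>2\<close> comes from the Koebe
  function: \<open>4 * Y / (1 + Y)\<^sup>2\<close> maps the unit disc conformally onto the plane
  without the ray from 1 to infinity, and taking \<open>n\<close>-th roots turns this ray into the
  \<open>n\<close> slits. Levels below 1 are used because their sublevel sets are compact subsets of
  the slit plane: boundedness makes the expected exit step finite, and a positive distance to the
  slits gives one Taylor error for all points. The obstacle is that Gaussian steps are unbounded, so
  the walk may overshoot the level and even jump across a slit. Test functions are therefore bounded
  on the whole plane, and the estimate for one step is required for steps of every length; for a
  long step the trivial bound is already a multiple of \<open>cmod y ^ 4\<close>. Path continuity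
  removes the overshoot in the limit. The law of \<open>Y\<close> on the circle of radius
  \<open>r\<close> is never identified. There
  \<open>cnj (Y ^ k) * Y ^ N = r ^ (2 * k) * Y ^ (N - k)\<close> for \<open>k < N\<close>, so
  vanishing moments alone make the powers orthogonal.\<close>

text \<open>This is the \<open>n\<close>-th power of the conformal map of the slit plane onto the unit disc, namely the
  solution \<open>Y\<close> of \<open>x\<^sup>n = 4 Y / (1 + Y)\<^sup>2\<close> with \<open>|Y| \<le> 1\<close>; using the power avoids the choice of a branch of the
  \<open>n\<close>-th root. On the slits its two boundary values are complex conjugates, which is why its modulus is
  continuous on the whole plane.\<close>

definition disc_power :: "nat \<Rightarrow> complex \<Rightarrow> complex" where
  "disc_power n x = (1 - csqrt (1 - x ^ n)) / (1 + csqrt (1 - x ^ n))"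

lemma Re_csqrt_nonneg: "0 \<le> Re (csqrt z)"
  using csqrt_principal[of z] by auto

lemma one_plus_csqrt_nonzero: "1 + csqrt z \<noteq> 0"
proof -
  have "Re (1 + csqrt z) > 0"
    using Re_csqrt_nonneg[of z] by (simp del: csqrt.simps)
  then show ?thesis by (metis zero_complex.sel(1) less_irrefl)
qed

lemma disc_power_0 [simp]: "n \<ge> 1 \<Longrightarrow> disc_power n 0 = 0"
  by (simp add: disc_power_def power_0_left)

lemma one_plus_disc_power: "1 + disc_power n x = 2 / (1 + csqrt (1 - x ^ n))"
  using one_plus_csqrt_nonzero[of "1 - x ^ n"] by (simp add: disc_power_def field_simps)

lemma one_plus_disc_power_nonzero: "1 + disc_power n x \<noteq> 0"
  using one_plus_csqrt_nonzero[of "1 - x ^ n"] by (simp add: one_plus_disc_power)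

lemma power_eq_disc_power: "x ^ n = 4 * disc_power n x / (1 + disc_power n x) ^ 2"
proof -
  define s where "s = csqrt (1 - x ^ n)"
  have s: "1 + s \<noteq> 0" "x ^ n = 1 - s\<^sup>2"
    using one_plus_csqrt_nonzero[of "1 - x ^ n"] by (auto simp: s_def)
  have "4 * disc_power n x / (1 + disc_power n x) ^ 2 = 4 * ((1 - s) / (1 + s)) / (2 / (1 + s))\<^sup>2"
    by (simp only: one_plus_disc_power) (simp only: disc_power_def s_def)
  also have "\<dots> = (1 - s) * (1 + s)"
    using s(1) by (simp add: power2_eq_square)
  finally have "4 * disc_power n x / (1 + disc_power n x) ^ 2 = 1 - s\<^sup>2"
    by (simp add: power2_eq_square algebra_simps)
  then show ?thesis using s by simp
qed

text \<open>On the negative real axis \<open>csqrt\<close> jumps, but only in its imaginary part.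
  The moduli of \<open>1 - s\<close> and \<open>1 + s\<close> involve \<open>s = csqrt u\<close>
  only through \<open>cmod s\<close> and \<open>Re s\<close>, so the modulus of the disc map does
  not see the jump.\<close>

lemma cmod_disc_power_sq:
  fixes n x defines "u \<equiv> 1 - x ^ n"
  shows "(cmod (disc_power n x))\<^sup>2 = (1 + cmod u - 2 * Re (csqrt u)) / (1 + cmod u + 2 * Re (csqrt u))"
proof -
  have eq: "(cmod s)\<^sup>2 = cmod (s\<^sup>2)" for s :: complex
    by (simp add: norm_power)
  have u: "(cmod (csqrt u))\<^sup>2 = cmod u" by (subst eq) simp
  have "(cmod (1 - csqrt u))\<^sup>2 = 1 + cmod u - 2 * Re (csqrt u)"
       "(cmod (1 + csqrt u))\<^sup>2 = 1 + cmod u + 2 * Re (csqrt u)"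
    using u unfolding cmod_power2 by (auto simp: power2_eq_square algebra_simps)
  then show ?thesis by (simp add: disc_power_def norm_divide power_divide u_def)
qed

lemma continuous_cmod_disc_power: "continuous_on UNIV (\<lambda>x. cmod (disc_power n x))"
proof -
  have pos: "1 + cmod u + 2 * Re (csqrt u) \<noteq> 0" for u
    using Re_csqrt_nonneg[of u] norm_ge_zero[of u] by linarith
  \<comment> \<open>Here \<open>Re (csqrt u)\<close> is written as the square root of
    \<open>(cmod u + Re u) / 2\<close>, which is continuous across the cut.\<close>
  have "continuous_on UNIV (\<lambda>x. sqrt ((1 + cmod (1 - x ^ n) - 2 * sqrt ((cmod (1 - x ^ n) + Re (1 - x ^ n)) / 2)) /
     (1 + cmod (1 - x ^ n) + 2 * sqrt ((cmod (1 - x ^ n) + Re (1 - x ^ n)) / 2))))"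
    using pos[of "1 - _ ^ n"] by (intro continuous_intros) (simp_all only: csqrt.sel, simp_all)
  also have "(\<lambda>x. sqrt ((1 + cmod (1 - x ^ n) - 2 * sqrt ((cmod (1 - x ^ n) + Re (1 - x ^ n)) / 2)) /
     (1 + cmod (1 - x ^ n) + 2 * sqrt ((cmod (1 - x ^ n) + Re (1 - x ^ n)) / 2)))) = (\<lambda>x. cmod (disc_power n x))"
    by (rule ext, rule real_sqrt_unique) (simp_all add: cmod_disc_power_sq del: csqrt.simps add: csqrt.sel)
  finally show ?thesis .
qed

text \<open>The Moebius map \<open>(1 - s) / (1 + s)\<close> sends the open right half plane onto
  the unit disc, and \<open>csqrt u\<close> has positive real part exactly off the cut.\<close>

lemma cmod_disc_power_less_1_iff: "cmod (disc_power n x) < 1 \<longleftrightarrow> 1 - x ^ n \<notin> \<real>\<^sub>\<le>\<^sub>0"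
proof -
  define u where "u = 1 - x ^ n"
  have "cmod (disc_power n x) < 1 \<longleftrightarrow> (cmod (disc_power n x))\<^sup>2 < 1"
    by (simp add: abs_square_less_1)
  also have "\<dots> \<longleftrightarrow> Re (csqrt u) > 0"
    unfolding cmod_disc_power_sq u_def[symmetric]
    using Re_csqrt_nonneg[of u] norm_ge_zero[of u] by (subst divide_less_eq_1_pos) linarith+
  also have "\<dots> \<longleftrightarrow> cmod u + Re u > 0"
    by (simp add: csqrt.sel)
  also have "\<dots> \<longleftrightarrow> u \<notin> \<real>\<^sub>\<le>\<^sub>0"
  proof -
    have "cmod u + Re u \<le> 0 \<longleftrightarrow> u \<in> \<real>\<^sub>\<le>\<^sub>0"
    proof
      assume "cmod u + Re u \<le> 0"
      then have "cmod u \<le> - Re u" by simp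
      moreover from this have "(cmod u)\<^sup>2 \<le> (- Re u)\<^sup>2" by (intro power_mono) auto
      ultimately show "u \<in> \<real>\<^sub>\<le>\<^sub>0"
        using norm_ge_zero[of u] unfolding cmod_power2 complex_nonpos_Reals_iff by (auto simp del: norm_ge_zero)
    next
      assume "u \<in> \<real>\<^sub>\<le>\<^sub>0"
      then show "cmod u + Re u \<le> 0"
        by (auto simp: complex_nonpos_Reals_iff cmod_def)
    qed
    then show ?thesis by linarith
  qed
  finally show ?thesis by (simp add: u_def)
qed

lemma slit_plane_eq: "n \<ge> 1 \<Longrightarrow> slit_plane n = {x. cmod (disc_power n x) < 1}"
proof -
  assume n: "n \<ge> 1"
  have "1 - x ^ n \<in> \<real>\<^sub>\<le>\<^sub>0 \<longleftrightarrow> 1 \<le> cmod x \<and> Arg (x ^ n) = 0" for x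
  proof -
    have "1 - x ^ n \<in> \<real>\<^sub>\<le>\<^sub>0 \<longleftrightarrow> 1 \<le> Re (x ^ n) \<and> Im (x ^ n) = 0"
      by (auto simp: complex_nonpos_Reals_iff)
    also have "\<dots> \<longleftrightarrow> 1 \<le> cmod (x ^ n) \<and> Arg (x ^ n) = 0"
    proof
      assume a: "1 \<le> Re (x ^ n) \<and> Im (x ^ n) = 0"
      then have "x ^ n = of_real (Re (x ^ n))" by (simp add: complex_eq_iff)
      moreover from a have "Re (x ^ n) > 0" by simp
      ultimately have "Arg (x ^ n) = 0" by (metis Arg_of_real less_irrefl not_less order_less_imp_le)
      with a show "1 \<le> cmod (x ^ n) \<and> Arg (x ^ n) = 0"
        using complex_Re_le_cmod order_trans by blast
    next
      assume a: "1 \<le> cmod (x ^ n) \<and> Arg (x ^ n) = 0"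
      then have "x ^ n \<in> \<real> \<and> 0 \<le> Re (x ^ n)"
        using Arg_eq_0 by blast
      then have "Im (x ^ n) = 0" "Re (x ^ n) = cmod (x ^ n)"
        by (auto simp: complex_is_Real_iff cmod_def)
      with a show "1 \<le> Re (x ^ n) \<and> Im (x ^ n) = 0" by simp
    qed
    also have "1 \<le> cmod (x ^ n) \<longleftrightarrow> 1 \<le> cmod x"
      using n power_less_one_iff[of "cmod x" n] by (auto simp: norm_power not_le[symmetric])
    finally show ?thesis .
  qed
  then show ?thesis
    unfolding slit_plane_def cmod_disc_power_less_1_iff by auto
qed

lemma open_slit_plane: "n \<ge> 1 \<Longrightarrow> open (slit_plane n)"
  unfolding slit_plane_eq by (intro open_Collect_less continuous_cmod_disc_power continuous_intros)

lemma holomorphic_disc_power: "n \<ge> 1 \<Longrightarrow> disc_power n holomorphic_on slit_plane n"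
  unfolding disc_power_def [abs_def]
  by (intro holomorphic_intros) (auto simp: slit_plane_eq cmod_disc_power_less_1_iff one_plus_csqrt_nonzero)

text \<open>Infinity corresponds to the boundary value \<open>Y = -1\<close>, from which all
  \<open>Y\<close> with \<open>cmod Y \<le> r\<close> keep the distance
  \<open>1 - r\<close>.\<close>

lemma bounded_disc_power_le:
  assumes "n \<ge> 1" "r < 1"
  shows "bounded {x. cmod (disc_power n x) \<le> r}"
proof -
  have "cmod x \<le> 1 + 4 / (1 - r)\<^sup>2" if x: "cmod (disc_power n x) \<le> r" for x
  proof -
    have r: "1 - r \<le> cmod (1 + disc_power n x)"
      using x norm_triangle_ineq2[of 1 "- disc_power n x"] by simp
    have "cmod x ^ n = 4 * cmod (disc_power n x) / (cmod (1 + disc_power n x))\<^sup>2"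
      by (subst norm_power[symmetric], subst power_eq_disc_power) (simp add: norm_divide norm_mult norm_power)
    also have "\<dots> \<le> 4 * 1 / (1 - r)\<^sup>2"
      using r x assms by (intro frac_le power_mono mult_left_mono) auto
    finally have le: "cmod x ^ n \<le> 4 / (1 - r)\<^sup>2" by simp
    show ?thesis
    proof (cases "cmod x \<le> 1")
      case True then show ?thesis using le by (smt (verit) zero_le_divide_iff zero_le_power2)
    next
      case False
      then have "cmod x \<le> cmod x ^ n" using assms by (intro self_le_power) auto
      then show ?thesis using le by simp
    qed
  qed
  then show ?thesis unfolding bounded_iff by auto
qed

text \<open>The power of \<open>1 + Y\<close> is taken before the modulus, so that the complex
  binomial series applies to it; for a real exponent the two operations commute.\<close>

lemma cmod_sq_disc_power:
  assumes "n \<ge> 1"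
  shows "(cmod x)\<^sup>2 = (4 * cmod (disc_power n x)) powr (2 / n) * (cmod ((1 + disc_power n x) powr (- 2 / n)))\<^sup>2"
proof (cases "x = 0")
  case True then show ?thesis using assms by simp
next
  case False
  define c where "c = cmod (1 + disc_power n x)"
  have c: "c > 0" using one_plus_disc_power_nonzero by (simp add: c_def)
  have "cmod x ^ n = 4 * cmod (disc_power n x) / c\<^sup>2"
    unfolding c_def
    by (subst norm_power[symmetric], subst power_eq_disc_power) (simp add: norm_divide norm_mult norm_power)
  then have "(cmod x powr n) powr (2 / n) = (4 * cmod (disc_power n x) / c\<^sup>2) powr (2 / n)"
    using False by (simp add: powr_realpow)
  also have "\<dots> = (4 * cmod (disc_power n x)) powr (2 / n) / (c powr 2) powr (2 / n)"
    using c by (simp add: powr_divide)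
  also have "(c powr 2) powr (2 / n) = (c powr (2 / n))\<^sup>2"
    by (simp add: powr_powr power2_eq_square powr_add[symmetric] del: powr_numeral)
  also have "(cmod x powr n) powr (2 / n) = cmod x powr 2"
    using assms by (simp add: powr_powr del: powr_numeral)
  finally have *: "cmod x powr 2 = (4 * cmod (disc_power n x)) powr (2 / n) / (c powr (2 / n))\<^sup>2" .
  have "cmod ((1 + disc_power n x) powr (- 2 / n)) = c powr (- 2 / n)"
    using norm_powr_real_powr'[of "complex_of_real (-2/n)" "1 + disc_power n x"] by (simp add: c_def)
  then have "cmod ((1 + disc_power n x) powr (- 2 / n)) = inverse (c powr (2 / n))"
    by (simp add: powr_minus)
  with * show ?thesis
    using False by (simp add: divide_inverse power_inverse)
qed

lemma borel_measurable_disc_power [measurable]: "disc_power n \<in> borel_measurable borel"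
proof -
  have "csqrt \<in> borel_measurable borel"
    by (subst borel_measurable_complex_iff) simp
  then show ?thesis unfolding disc_power_def [abs_def] by measurable
qed

text \<open>Averaging over the four rotations removes \<open>y ^ k\<close> unless 4 divides
  \<open>k\<close>, so the Taylor terms of orders 1 to 3 disappear. Cauchy's inequality on the
  circle of radius \<open>d / 2\<close> bounds the rest by a geometric series of ratio
  \<open>t = 2 * cmod y / d \<le> 1 / 2\<close>; the constant is
  \<open>32 = 2 * 2 ^ 4\<close>.\<close>

lemma holomorphic_four_point_average:
  assumes hol: "f holomorphic_on ball x d" and B: "\<And>z. z \<in> ball x d \<Longrightarrow> cmod (f z) \<le> B"
    and d: "0 < d" and y: "cmod y \<le> d / 4"
  shows "cmod ((f (x + y) + f (x + \<i> * y) + f (x - y) + f (x - \<i> * y)) / 4 - f x) \<le> 32 * B / d ^ 4 * cmod y ^ 4"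
proof -
  define c where "c k = (deriv ^^ k) f x / fact k" for k
  define t where "t = 2 * cmod y / d"
  define e where "e k = c k * y ^ k * ((1 + \<i> ^ k + (- 1) ^ k + (- \<i>) ^ k) / 4)" for k
  have t: "0 \<le> t" "t \<le> 1 / 2" using y d by (auto simp: t_def field_simps)
  have B0: "0 \<le> B" using B[of x] d norm_ge_zero order_trans by (metis centre_in_ball)
  have c: "cmod (c k) \<le> B * (2 / d) ^ k" for k
  proof -
    have "cmod ((deriv ^^ k) f x) \<le> fact k * B / (d / 2) ^ k"
      using d by (intro Cauchy_inequality holomorphic_on_subset[OF hol] B
          holomorphic_on_imp_continuous_on[OF holomorphic_on_subset[OF hol]]) (auto simp: dist_norm norm_minus_commute)
    then show ?thesis by (simp add: c_def norm_divide field_simps)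
  qed
  have ser: "(\<lambda>k. c k * (w * y) ^ k) sums f (x + w * y)" if "cmod w = 1" for w
  proof -
    have "x + w * y \<in> ball x d" using that y d by (simp add: dist_norm norm_mult)
    from holomorphic_power_series[OF hol this] show ?thesis by (simp add: c_def)
  qed
  have "(\<lambda>k. (c k * (1 * y) ^ k + c k * (\<i> * y) ^ k + c k * (- 1 * y) ^ k + c k * (- \<i> * y) ^ k) / 4) sums
     ((f (x + 1 * y) + f (x + \<i> * y) + f (x + - 1 * y) + f (x + - \<i> * y)) / 4)"
    by (intro sums_divide sums_add ser) auto
  also have "(\<lambda>k. (c k * (1 * y) ^ k + c k * (\<i> * y) ^ k + c k * (- 1 * y) ^ k + c k * (- \<i> * y) ^ k) / 4) = e"
    unfolding power_mult_distrib e_def by (simp add: fun_eq_iff field_simps)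
  finally have "e sums ((f (x + y) + f (x + \<i> * y) + f (x - y) + f (x - \<i> * y)) / 4)"
    by simp
  from sums_split_initial_segment[OF this, of 4]
  have s: "(\<lambda>k. e (k + 4)) sums ((f (x + y) + f (x + \<i> * y) + f (x - y) + f (x - \<i> * y)) / 4 - f x)"
    by (simp add: e_def c_def eval_nat_numeral)
  have e: "cmod (e (k + 4)) \<le> B * t ^ 4 * t ^ k" for k
  proof -
    have "cmod ((1 + \<i> ^ m + (- 1) ^ m + (- \<i>) ^ m) / 4) \<le> 1" for m
    proof -
      have "cmod (1 + \<i> ^ m + (- 1) ^ m + (- \<i>) ^ m) \<le> 1 + 1 + 1 + 1"
        by (intro norm_triangle_mono) (auto simp: norm_power)
      then show ?thesis by (simp add: norm_divide)
    qed
    then have "cmod (e (k + 4)) \<le> (B * (2 / d) ^ (k + 4)) * cmod y ^ (k + 4) * 1"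
      unfolding e_def norm_mult norm_power using c[of "k + 4"] B0 d
      by (intro mult_mono) (auto intro!: mult_nonneg_nonneg)
    also have "\<dots> = B * t ^ (k + 4)" by (simp add: t_def power_mult_distrib power_divide)
    finally show ?thesis by (simp add: power_add mult_ac)
  qed
  have g: "(\<lambda>k. B * t ^ 4 * t ^ k) sums (B * t ^ 4 * (1 / (1 - t)))"
    using t by (intro sums_mult geometric_sums) auto
  have "cmod ((f (x + y) + f (x + \<i> * y) + f (x - y) + f (x - \<i> * y)) / 4 - f x) \<le> B * t ^ 4 * (1 / (1 - t))"
    by (rule norm_sums_le[OF s g e])
  also have "\<dots> \<le> B * t ^ 4 * 2"
    using t B0 by (intro mult_left_mono) (auto simp: field_simps)
  also have "\<dots> = 32 * B / d ^ 4 * cmod y ^ 4"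
    by (simp add: t_def power_mult_distrib power_divide)
  finally show ?thesis .
qed

section \<open>The sum of squared binomial coefficients\<close>

lemma gbinomial_minus_sq: "((- a) gchoose k)\<^sup>2 = (pochhammer a k / fact k)\<^sup>2" for a :: real
  by (simp add: gbinomial_pochhammer power_mult_distrib power_divide power_mult[symmetric] mult.commute[of k])

text \<open>At the borderline \<open>a = 1 / 2\<close> the squares decay only like a multiple of
  \<open>1 / k\<close>. The induction keeps \<open>k\<close> times the \<open>k\<close>-th square
  above \<open>1 / 4\<close>, and the harmonic series is a minorant.\<close>

lemma suminf_gbinomial_sq_infinite:
  fixes a :: real assumes a: "a \<ge> 1 / 2"
  shows "(\<Sum>k. ennreal (((- a) gchoose k)\<^sup>2)) = \<infinity>"
proof (rule ccontr)
  assume "(\<Sum>k. ennreal (((- a) gchoose k)\<^sup>2)) \<noteq> \<infinity>"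
  then have s: "summable (\<lambda>k. ((- a) gchoose k)\<^sup>2)"
    by (intro summable_suminf_not_top) auto
  have le: "1 / 4 \<le> real (Suc k) * ((- a) gchoose Suc k)\<^sup>2" for k
  proof (induction k)
    case 0
    have "(1 / 2) ^ 2 \<le> a ^ 2" using a by (intro power_mono) auto
    then show ?case by (simp add: power2_eq_square)
  next
    case (Suc k)
    have step: "pochhammer a (Suc (Suc k)) / fact (Suc (Suc k)) = (pochhammer a (Suc k) / fact (Suc k)) * ((a + Suc k) / real (Suc (Suc k)))"
      by (simp add: pochhammer_Suc [of a "Suc k"] fact_Suc[of "Suc k"] del: pochhammer_Suc fact_Suc)
    define u where "u = (pochhammer a (Suc k) / fact (Suc k))\<^sup>2"
    \<comment> \<open>With \<open>m = Suc k\<close> this is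
      \<open>m * (m + 1) \<le> (m + 1 / 2)\<^sup>2\<close>; together with
      \<open>1 / 2 \<le> a\<close> it says that \<open>m\<close> times the \<open>m\<close>-th
      square does not decrease.\<close>
    have "real (Suc k) * real (Suc (Suc k)) \<le> (1 / 2 + real (Suc k))\<^sup>2"
      by (simp add: power2_eq_square algebra_simps)
    also have "\<dots> \<le> (a + Suc k)\<^sup>2" using a by (intro power_mono) auto
    finally have "real (Suc k) \<le> (a + Suc k)\<^sup>2 / real (Suc (Suc k))"
      by (simp add: pos_le_divide_eq del: of_nat_Suc)
    then have "real (Suc k) * u \<le> (a + Suc k)\<^sup>2 / real (Suc (Suc k)) * u"
      by (intro mult_right_mono) (simp_all add: u_def)
    also have "\<dots> = real (Suc (Suc k)) * (u * ((a + Suc k) / real (Suc (Suc k)))\<^sup>2)"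
      by (simp add: power_divide power2_eq_square del: of_nat_Suc)
    also have "u * ((a + Suc k) / real (Suc (Suc k)))\<^sup>2 = ((- a) gchoose Suc (Suc k))\<^sup>2"
      unfolding gbinomial_minus_sq step u_def by (simp only: power_mult_distrib)
    finally show ?case using Suc unfolding u_def gbinomial_minus_sq[symmetric] by linarith
  qed
  have "summable (\<lambda>k. 1 / 4 * (1 / real (Suc k)))"
  proof (rule summable_comparison_test')
    show "summable (\<lambda>k. ((- a) gchoose Suc k)\<^sup>2)" using s by (subst summable_Suc_iff)
    show "norm (1 / 4 * (1 / real (Suc k))) \<le> ((- a) gchoose Suc k)\<^sup>2" for k
      using le[of k] by (simp add: field_simps)
  qed
  then have "summable (\<lambda>k. 1 / real (Suc k))" by (subst (asm) summable_cmult_iff) simp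
  then have "summable (\<lambda>k. 1 / real k)" by (subst (asm) summable_Suc_iff)
  then show False using not_summable_harmonic[where ?'a = real] by (simp add: inverse_eq_divide)
qed

lemma nn_integral_Beta:
  fixes a b :: real assumes "a > 0" "b > 0"
  shows "(\<integral>\<^sup>+t. ennreal (indicator {0<..<1} t * (t powr (a - 1) * (1 - t) powr (b - 1))) \<partial>lborel) = ennreal (Beta a b)"
proof -
  have "((\<lambda>t. t powr (a - 1) * (1 - t) powr (b - 1)) has_integral Beta a b) {0<..<1}"
    using has_integral_Beta_real[OF assms] by (simp add: has_integral_Icc_iff_Ioo)
  from nn_integral_has_integral_lebesgue[OF _ this] show ?thesis by simp
qed

text \<open>The Beta integral turns one of the two binomial factors into a moment sequence, and the
  remaining sum is a binomial series under the integral.\<close>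

lemma suminf_gbinomial_sq:
  fixes a :: real assumes a: "0 < a" "a < 1 / 2"
  shows "(\<Sum>k. ennreal (((- a) gchoose k)\<^sup>2)) = ennreal (Gamma (1 - 2 * a) / (Gamma (1 - a))\<^sup>2)"
proof -
  define c where "c k = pochhammer a k / fact k" for k
  have c0: "0 \<le> c k" for k using a by (simp add: c_def pochhammer_nonneg)
  have G: "Gamma a > 0" "Gamma (1 - a) > 0" "Gamma (1 - 2 * a) > 0"
    using a by (auto intro!: Gamma_real_pos)
  \<comment> \<open>The denominator of this Beta value is \<open>Gamma (k + 1) = fact k\<close>, so
    it equals \<open>c k\<close> up to a factor free of \<open>k\<close>, and the product with
    \<open>c k\<close> is a square.\<close>
  have B: "c k * Beta (a + k) (1 - a) = (Gamma a * Gamma (1 - a)) * (c k)\<^sup>2" for k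
  proof -
    have "a \<notin> \<int>\<^sub>\<le>\<^sub>0" using a nonpos_Ints_nonpos by fastforce
    then have "pochhammer a k = Gamma (a + k) / Gamma a" by (rule pochhammer_Gamma)
    then have "Gamma (a + k) = Gamma a * pochhammer a k" using G by (simp add: field_simps)
    moreover have "Gamma (a + k + (1 - a)) = fact k"
      using Gamma_fact[of k, where ?'a = real] by (simp add: add.commute)
    ultimately show ?thesis by (simp add: Beta_def c_def power2_eq_square)
  qed
  let ?w = "\<lambda>t::real. indicator {0<..<1} t :: real"
  have "(\<Sum>k. ennreal (c k * Beta (a + k) (1 - a))) =
      (\<Sum>k. \<integral>\<^sup>+t. ennreal (c k) * ennreal (?w t * (t powr (a + k - 1) * (1 - t) powr (1 - a - 1))) \<partial>lborel)"
    using a c0 by (intro suminf_cong, subst nn_integral_cmult, measurable, subst nn_integral_Beta)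
        (auto simp: ennreal_mult')
  also have "\<dots> = (\<integral>\<^sup>+t. (\<Sum>k. ennreal (c k) * ennreal (?w t * (t powr (a + k - 1) * (1 - t) powr (1 - a - 1)))) \<partial>lborel)"
    by (intro nn_integral_suminf[symmetric]) measurable
  \<comment> \<open>Summing over \<open>k\<close> first gives the binomial series of
    \<open>(1 - t) powr (- a)\<close>. It changes the exponent of \<open>1 - t\<close> from
    \<open>- a\<close> to \<open>- 2 * a\<close>, which is integrable at 1 because
    \<open>a < 1 / 2\<close>.\<close>
  also have "\<dots> = (\<integral>\<^sup>+t. ennreal (?w t * (t powr (a - 1) * (1 - t) powr ((1 - 2 * a) - 1))) \<partial>lborel)"
  proof (intro nn_integral_cong)
    fix t :: real
    show "(\<Sum>k. ennreal (c k) * ennreal (?w t * (t powr (a + k - 1) * (1 - t) powr (1 - a - 1)))) =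
      ennreal (?w t * (t powr (a - 1) * (1 - t) powr ((1 - 2 * a) - 1)))"
    proof (cases "t \<in> {0<..<1}")
      case t: True
      have "(\<lambda>k. ((- a) gchoose k) * (- t) ^ k) sums (1 + (- t)) powr (- a)"
        using t by (intro gen_binomial_real) auto
      moreover have "((- a) gchoose k) * (- t) ^ k = c k * t ^ k" for k
        by (simp add: c_def gbinomial_pochhammer power_mult_distrib[symmetric])
      ultimately have "(\<lambda>k. c k * t ^ k) sums (1 - t) powr (- a)" by simp
      then have "(\<lambda>k. c k * t ^ k * (t powr (a - 1) * (1 - t) powr (- a))) sums
          ((1 - t) powr (- a) * (t powr (a - 1) * (1 - t) powr (- a)))"
        by (rule sums_mult2)
      moreover have "c k * t ^ k * (t powr (a - 1) * (1 - t) powr (- a)) =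
         c k * (t powr (a + k - 1) * (1 - t) powr (1 - a - 1))" for k
        using t by (simp add: powr_realpow[symmetric] powr_add[symmetric] algebra_simps)
      ultimately have s: "(\<lambda>k. c k * (t powr (a + k - 1) * (1 - t) powr (1 - a - 1))) sums
          ((1 - t) powr (- a) * (t powr (a - 1) * (1 - t) powr (- a)))" by simp
      have "(\<Sum>k. ennreal (c k * (t powr (a + k - 1) * (1 - t) powr (1 - a - 1)))) =
          ennreal ((1 - t) powr (- a) * (t powr (a - 1) * (1 - t) powr (- a)))"
        using c0 by (intro suminf_ennreal_eq s) auto
      also have "(1 - t) powr (- a) * (t powr (a - 1) * (1 - t) powr (- a)) = t powr (a - 1) * (1 - t) powr ((1 - 2 * a) - 1)"
        using t by (simp add: powr_add[symmetric])
      finally show ?thesis using t c0 by (simp add: ennreal_mult')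
    qed auto
  qed
  also have "\<dots> = ennreal (Beta a (1 - 2 * a))" using a by (intro nn_integral_Beta) auto
  finally have "(\<Sum>k. ennreal (Gamma a * Gamma (1 - a)) * ennreal ((c k)\<^sup>2)) = ennreal (Beta a (1 - 2 * a))"
    using G by (simp add: B ennreal_mult')
  then have "ennreal (Gamma a * Gamma (1 - a)) * (\<Sum>k. ennreal ((c k)\<^sup>2)) = ennreal (Beta a (1 - 2 * a))"
    by simp
  also have "Beta a (1 - 2 * a) = Gamma a * Gamma (1 - a) * (Gamma (1 - 2 * a) / (Gamma (1 - a))\<^sup>2)"
    using G by (simp add: Beta_def power2_eq_square)
  finally have "ennreal (Gamma a * Gamma (1 - a)) * (\<Sum>k. ennreal ((c k)\<^sup>2)) = ennreal (Gamma a * Gamma (1 - a)) * ennreal (Gamma (1 - 2 * a) / (Gamma (1 - a))\<^sup>2)"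
    using G by (simp only: ennreal_mult'[of "Gamma a * Gamma (1 - a)"] mult_pos_pos less_imp_le)
  then show ?thesis
    using G by (subst (asm) ennreal_mult_cancel_left) (auto simp: gbinomial_minus_sq c_def mult_eq_0_iff)
qed

text \<open>Legendre's duplication formula at \<open>1 / 2 - a\<close> has
  \<open>Gamma (1 - a)\<close> as its second factor, which cancels one of the two copies in the
  denominator.\<close>

lemma Gamma_value_rewrite:
  fixes a :: real assumes "0 < a" "a < 1 / 2"
  shows "4 powr a / 2 * (Gamma (1 - 2 * a) / (Gamma (1 - a))\<^sup>2) = Gamma (1 / 2 - a) / (2 * sqrt pi * Gamma (1 - a))"
proof -
  have "complex_of_real (1 / 2 - a) \<notin> \<int>\<^sub>\<le>\<^sub>0" "complex_of_real (1 / 2 - a) + 1 / 2 \<notin> \<int>\<^sub>\<le>\<^sub>0"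
    using assms by (auto elim!: nonpos_Ints_cases simp: complex_eq_iff)
  from Gamma_legendre_duplication[OF this]
  have "complex_of_real (Gamma (1 / 2 - a) * Gamma (1 - a)) =
     of_real (exp ((1 - 2 * (1 / 2 - a)) * ln 2) * sqrt pi * Gamma (1 - 2 * a))"
    by (simp add: Gamma_complex_of_real [symmetric] exp_of_real [symmetric] of_real_diff algebra_simps)
  then have "Gamma (1 / 2 - a) * Gamma (1 - a) = exp ((1 - 2 * (1 / 2 - a)) * ln 2) * sqrt pi * Gamma (1 - 2 * a)"
    by (subst (asm) of_real_eq_iff)
  also have "exp ((1 - 2 * (1 / 2 - a)) * ln 2) = (2 powr 2) powr a"
    unfolding powr_powr by (simp add: powr_def)
  also have "2 powr 2 = (4::real)" by simp
  finally have "Gamma (1 / 2 - a) * Gamma (1 - a) = 4 powr a * sqrt pi * Gamma (1 - 2 * a)" .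
  moreover have "Gamma (1 - a) > 0" using assms by (intro Gamma_real_pos) auto
  ultimately show ?thesis by (simp add: field_simps power2_eq_square)
qed

section \<open>Rotationally symmetric random walks\<close>

text \<open>Invariance under a quarter turn suffices: averaging over the four rotations removes the terms of
  orders one to three in the expansion of a holomorphic function, so that one step changes its
  expectation only by a multiple of the fourth moment.\<close>

locale planar_walk = prob_space M for M :: "'a measure" +
  fixes xi :: "nat \<Rightarrow> 'a \<Rightarrow> complex" and h :: real
  assumes indep_xi: "indep_vars (\<lambda>_. borel) xi {..<k}"
    and rotation: "distr M borel (\<lambda>\<omega>. \<i> * xi k \<omega>) = distr M borel (xi k)"
    and second_moment: "has_bochner_integral M (\<lambda>\<omega>. (cmod (xi k \<omega>))\<^sup>2) (2 * h)"
    and fourth_moment: "has_bochner_integral M (\<lambda>\<omega>. (cmod (xi k \<omega>)) ^ 4) (8 * h\<^sup>2)"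
    and h_pos: "0 < h"
begin

definition walk :: "nat \<Rightarrow> 'a \<Rightarrow> complex" where
  "walk k \<omega> = (\<Sum>i<k. xi i \<omega>)"

text \<open>With \<open>j\<close> running up to \<open>k\<close> inclusive, this is the event that
  the step from \<open>walk k\<close> to \<open>walk (Suc k)\<close> is still taken. It is
  determined by the increments before \<open>xi k\<close>, hence independent of
  \<open>xi k\<close>.\<close>

definition alive :: "complex set \<Rightarrow> nat \<Rightarrow> 'a set" where
  "alive U k = {\<omega> \<in> space M. \<forall>j\<le>k. walk j \<omega> \<in> U}"

text \<open>The indicator of \<open>alive U k\<close> as a function on the product space of past
  increments, where independence and rotation invariance can be applied to it.\<close>

definition alive_past :: "complex set \<Rightarrow> nat \<Rightarrow> (nat \<Rightarrow> complex) \<Rightarrow> real" where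
  "alive_past U k t = (if \<forall>j\<le>k. (\<Sum>i<j. t i) \<in> U then 1 else 0)"

text \<open>In this recursive form the step from \<open>k\<close> to \<open>Suc k\<close> changes
  the value only on \<open>alive U k\<close>, and there by one increment of the walk, so
  expectations telescope.\<close>

fun stopped :: "complex set \<Rightarrow> nat \<Rightarrow> 'a \<Rightarrow> complex" where
  "stopped U 0 \<omega> = 0"
| "stopped U (Suc k) \<omega> = (if \<omega> \<in> alive U k then walk (Suc k) \<omega> else stopped U k \<omega>)"

lemma measurable_xi [measurable]: "xi k \<in> borel_measurable M"
  using indep_xi[of "Suc k"] by (auto simp: indep_vars_def)

lemma measurable_walk [measurable]: "walk k \<in> borel_measurable M"
  unfolding walk_def [abs_def] by measurable

lemma sets_alive: "U \<in> sets borel \<Longrightarrow> alive U k \<in> events"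
proof -
  assume U: "U \<in> sets borel"
  have "alive U k = (\<Inter>j\<in>{..k}. walk j -` U \<inter> space M)"
    by (auto simp: alive_def)
  then show ?thesis
    using measurable_sets[OF measurable_walk U] by (simp only:) (intro sets.finite_INT, auto)
qed

lemma measurable_stopped: "U \<in> sets borel \<Longrightarrow> stopped U k \<in> borel_measurable M"
proof (induction k)
  case (Suc k)
  have [measurable]: "alive U k \<in> events" "stopped U k \<in> borel_measurable M"
    using Suc sets_alive by auto
  show ?case by simp
next
  case 0
  have "stopped U 0 = (\<lambda>_. 0)" by (simp add: fun_eq_iff)
  then show ?case by simp
qed

lemma stopped_alive: "\<omega> \<in> alive U k \<Longrightarrow> stopped U k \<omega> = walk k \<omega>"
  by (cases k) (auto simp: walk_def alive_def)

lemma indep_past: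
  "indep_var (PiM {..<k} (\<lambda>_. borel)) (\<lambda>\<omega>. \<lambda>i\<in>{..<k}. xi i \<omega>) (PiM {k} (\<lambda>_. borel)) (\<lambda>\<omega>. \<lambda>i\<in>{k}. xi k \<omega>)"
proof -
  have "indep_var (PiM {..<k} (\<lambda>_. borel)) (\<lambda>\<omega>. restrict (\<lambda>i. xi i \<omega>) {..<k})
     (PiM {k} (\<lambda>_. borel)) (\<lambda>\<omega>. restrict (\<lambda>i. xi i \<omega>) {k})"
    by (rule indep_var_restrict[OF indep_xi[of "Suc k"]]) auto
  also have "(\<lambda>\<omega>. restrict (\<lambda>i. xi i \<omega>) {k}) = (\<lambda>\<omega>. \<lambda>i\<in>{k}. xi k \<omega>)"
    by (auto simp: fun_eq_iff)
  finally show ?thesis .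
qed

text \<open>The joint law of the past and the next increment is a product, and a quarter turn
  preserves its second factor.\<close>

lemma rotation_past:
  fixes G :: "(nat \<Rightarrow> complex) \<times> complex \<Rightarrow> complex"
  assumes [measurable]: "G \<in> borel_measurable (PiM {..<k} (\<lambda>_. borel) \<Otimes>\<^sub>M borel)"
  shows "(\<integral>\<omega>. G (\<lambda>i\<in>{..<k}. xi i \<omega>, \<i> * xi k \<omega>) \<partial>M) = (\<integral>\<omega>. G (\<lambda>i\<in>{..<k}. xi i \<omega>, xi k \<omega>) \<partial>M)"
proof -
  let ?T = "\<lambda>\<omega>. \<lambda>i\<in>{..<k}. xi i \<omega>" and ?P = "PiM {..<k} (\<lambda>_. borel) :: (nat \<Rightarrow> complex) measure"
  let ?K = "PiM {k} (\<lambda>_. borel) :: (nat \<Rightarrow> complex) measure"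
  \<comment> \<open>\<open>indep_past\<close> speaks about product spaces, so a single increment is
    packed as a function on \<open>{k}\<close> and read off again by \<open>snd z k\<close>.\<close>
  let ?c = "\<lambda>y. \<lambda>i\<in>{k}. y :: complex"
  have c: "?c \<in> borel \<rightarrow>\<^sub>M ?K" by (intro measurable_restrict) auto
  have rot: "(\<lambda>t. \<lambda>i\<in>{k}. \<i> * t k) \<in> ?K \<rightarrow>\<^sub>M ?K"
    by (intro measurable_restrict borel_measurable_times measurable_component_singleton) auto
  have "indep_var ?P ?T ?K (\<lambda>\<omega>. ?c (\<i> * xi k \<omega>))"
    using indep_var_compose[OF indep_past[of k] measurable_ident rot] by (simp add: comp_def id_def)
  moreover have "distr M ?K (\<lambda>\<omega>. ?c (\<i> * xi k \<omega>)) = distr M ?K (\<lambda>\<omega>. ?c (xi k \<omega>))"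
  proof -
    have "distr M ?K (\<lambda>\<omega>. ?c (\<i> * xi k \<omega>)) = distr (distr M borel (\<lambda>\<omega>. \<i> * xi k \<omega>)) ?K ?c"
      by (subst distr_distr[OF c]) (simp_all add: comp_def)
    also have "\<dots> = distr M ?K (\<lambda>\<omega>. ?c (xi k \<omega>))"
      by (subst rotation, subst distr_distr[OF c]) (simp_all add: comp_def)
    finally show ?thesis .
  qed
  ultimately have "distr M (?P \<Otimes>\<^sub>M ?K) (\<lambda>\<omega>. (?T \<omega>, ?c (\<i> * xi k \<omega>))) = distr M (?P \<Otimes>\<^sub>M ?K) (\<lambda>\<omega>. (?T \<omega>, ?c (xi k \<omega>)))"
    using indep_past[of k] unfolding indep_var_distribution_eq by auto
  then have "(\<integral>z. G (fst z, snd z k) \<partial>distr M (?P \<Otimes>\<^sub>M ?K) (\<lambda>\<omega>. (?T \<omega>, ?c (\<i> * xi k \<omega>)))) =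
      (\<integral>z. G (fst z, snd z k) \<partial>distr M (?P \<Otimes>\<^sub>M ?K) (\<lambda>\<omega>. (?T \<omega>, ?c (xi k \<omega>))))"
    by simp
  moreover have "(\<lambda>z. G (fst z, snd z k)) \<in> borel_measurable (?P \<Otimes>\<^sub>M ?K)"
    using measurable_component_singleton[of k "{k}" "\<lambda>_. borel :: complex measure", measurable] by measurable
  ultimately show ?thesis
    using measurable_compose[OF measurable_xi c, of k] measurable_compose[OF _ c, of "\<lambda>\<omega>. \<i> * xi k \<omega>" M]
    by (subst (asm) (1 2) integral_distr) simp_all
qed

lemma walk_past: "j \<le> k \<Longrightarrow> walk j \<omega> = (\<Sum>i<j. (\<lambda>i\<in>{..<k}. xi i \<omega>) i)"
  unfolding walk_def by (intro sum.cong) auto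

lemma indicator_alive_past:
  "\<omega> \<in> space M \<Longrightarrow> indicat_real (alive U k) \<omega> = alive_past U k (\<lambda>i\<in>{..<k}. xi i \<omega>)"
  unfolding alive_def alive_past_def by (auto simp: indicator_def walk_past[of _ k, symmetric] simp del: restrict_apply)

lemma measurable_alive_past:
  fixes k :: nat
  assumes U: "U \<in> sets borel"
  shows "alive_past U k \<in> borel_measurable (PiM {..<k} (\<lambda>_. borel :: complex measure))"
proof -
  let ?P = "PiM {..<k} (\<lambda>_. borel :: complex measure)"
  have "(\<lambda>t. \<Sum>i<j. t i) \<in> borel_measurable ?P" if "j \<le> k" for j
    using that by (intro borel_measurable_sum measurable_component_singleton) (auto intro: less_le_trans)
  then have "(\<lambda>t. \<Sum>i<j. t i) -` U \<inter> space ?P \<in> sets ?P" if "j \<le> k" for j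
    using that U by (intro measurable_sets[of _ _ borel])
  then have "(\<Inter>j\<in>{..k}. (\<lambda>t. \<Sum>i<j. t i) -` U \<inter> space ?P) \<in> sets ?P"
    by (intro sets.finite_INT) auto
  also have "(\<Inter>j\<in>{..k}. (\<lambda>t. \<Sum>i<j. t i) -` U \<inter> space ?P) = {t \<in> space ?P. \<forall>j\<le>k. (\<Sum>i<j. t i) \<in> U}"
    by auto
  finally show ?thesis
    unfolding alive_past_def [abs_def] by (rule measurable_If[OF borel_measurable_const borel_measurable_const])
qed

lemma integral_alive_mult:
  assumes U: "U \<in> sets borel" and [measurable]: "f \<in> borel_measurable borel" and f: "integrable M (\<lambda>\<omega>. f (xi k \<omega>))"
  shows "integrable M (\<lambda>\<omega>. indicat_real (alive U k) \<omega> * (f (xi k \<omega>) :: real))"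
    "(\<integral>\<omega>. indicat_real (alive U k) \<omega> * f (xi k \<omega>) \<partial>M) = prob (alive U k) * (\<integral>\<omega>. f (xi k \<omega>) \<partial>M)"
proof -
  have ind: "indep_var borel (\<lambda>\<omega>. alive_past U k (\<lambda>i\<in>{..<k}. xi i \<omega>)) borel (\<lambda>\<omega>. f (xi k \<omega>))"
  proof -
    have "(\<lambda>t. t k) \<in> borel_measurable (PiM {k} (\<lambda>_. borel :: complex measure))"
      by (rule measurable_component_singleton) simp
    then have "(\<lambda>t. f (t k)) \<in> borel_measurable (PiM {k} (\<lambda>_. borel :: complex measure))"
      by (rule measurable_compose) fact
    from indep_var_compose[OF indep_past measurable_alive_past[OF U] this]
    show ?thesis by (simp only: comp_def restrict_apply singletonI if_True)
  qed
  have [measurable]: "alive U k \<in> events" using U by (rule sets_alive)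
  have "integrable M (\<lambda>\<omega>. alive_past U k (\<lambda>i\<in>{..<k}. xi i \<omega>)) \<longleftrightarrow> integrable M (indicat_real (alive U k))"
    by (intro Bochner_Integration.integrable_cong refl indicator_alive_past[symmetric])
  moreover have "integrable M (indicat_real (alive U k))"
    by (rule integrable_real_indicator) (auto simp: emeasure_eq_measure)
  ultimately have b: "integrable M (\<lambda>\<omega>. alive_past U k (\<lambda>i\<in>{..<k}. xi i \<omega>))"
    by simp
  have "integrable M (\<lambda>\<omega>. indicat_real (alive U k) \<omega> * f (xi k \<omega>)) \<longleftrightarrow>
      integrable M (\<lambda>\<omega>. alive_past U k (\<lambda>i\<in>{..<k}. xi i \<omega>) * f (xi k \<omega>))"
    by (intro Bochner_Integration.integrable_cong refl) (simp only: indicator_alive_past)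
  then show "integrable M (\<lambda>\<omega>. indicat_real (alive U k) \<omega> * (f (xi k \<omega>) :: real))"
    using indep_var_integrable[OF ind b f] by simp
  have "(\<integral>\<omega>. indicat_real (alive U k) \<omega> * f (xi k \<omega>) \<partial>M) = (\<integral>\<omega>. alive_past U k (\<lambda>i\<in>{..<k}. xi i \<omega>) * f (xi k \<omega>) \<partial>M)"
    by (intro Bochner_Integration.integral_cong) (simp_all only: indicator_alive_past)
  also have "\<dots> = (\<integral>\<omega>. alive_past U k (\<lambda>i\<in>{..<k}. xi i \<omega>) \<partial>M) * (\<integral>\<omega>. f (xi k \<omega>) \<partial>M)"
    by (rule indep_var_lebesgue_integral[OF ind b f])
  also have "(\<integral>\<omega>. alive_past U k (\<lambda>i\<in>{..<k}. xi i \<omega>) \<partial>M) = (\<integral>\<omega>. indicat_real (alive U k) \<omega> \<partial>M)"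
    by (intro Bochner_Integration.integral_cong) (simp_all only: indicator_alive_past)
  also have "\<dots> = prob (alive U k)" by (simp add: sets_alive U)
  finally show "(\<integral>\<omega>. indicat_real (alive U k) \<omega> * f (xi k \<omega>) \<partial>M) = prob (alive U k) * (\<integral>\<omega>. f (xi k \<omega>) \<partial>M)" .
qed

text \<open>By \<open>rotation_past\<close> the next increment may be replaced by any of its
  rotations, so the expected change of \<Phi> is that of its four-point average. The number
  \<open>c\<close> is a quarter of the Laplacian: 1 for the squared modulus and 0 for holomorphic
  functions. In \<open>avg\<close> the step \<open>y\<close> is arbitrary because the next position
  may lie far outside \<open>U\<close>.\<close>

lemma one_step:
  fixes \<Phi> :: "complex \<Rightarrow> complex"
  assumes U [measurable]: "U \<in> sets borel" and \<Phi> [measurable]: "\<Phi> \<in> borel_measurable borel"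
    and bound: "\<And>x. cmod (\<Phi> x) \<le> B"
    and avg: "\<And>x y. x \<in> U \<Longrightarrow> cmod ((\<Phi> (x + y) + \<Phi> (x + \<i> * y) + \<Phi> (x - y) + \<Phi> (x - \<i> * y)) / 4 - \<Phi> x
        - c * of_real ((cmod y)\<^sup>2)) \<le> C * cmod y ^ 4"
  shows "cmod ((\<integral>\<omega>. indicat_real (alive U k) \<omega> *\<^sub>R (\<Phi> (walk (Suc k) \<omega>) - \<Phi> (walk k \<omega>)) \<partial>M)
     - c * of_real (2 * h * prob (alive U k))) \<le> 8 * C * h\<^sup>2 * prob (alive U k)"
proof -
  have [measurable]: "alive U k \<in> events" using U by (rule sets_alive)
  let ?I = "indicat_real (alive U k)"
  have int: "integrable M (\<lambda>\<omega>. ?I \<omega> *\<^sub>R \<Phi> (f \<omega>))" if [measurable]: "f \<in> borel_measurable M" for f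
    by (rule integrable_const_bound[of _ B]) (use bound order_trans[OF norm_ge_zero bound] in \<open>auto simp: indicator_def\<close>)
  define E where "E w = (\<integral>\<omega>. ?I \<omega> *\<^sub>R \<Phi> (walk k \<omega> + w * xi k \<omega>) \<partial>M)" for w
  have rot: "E (\<i> * w) = E w" for w
  proof -
    define G where "G = (\<lambda>(t, y). alive_past U k t *\<^sub>R \<Phi> ((\<Sum>i<k. t i) + w * (y :: complex)))"
    have [measurable]: "(\<lambda>t. \<Sum>i<k. t i) \<in> borel_measurable (PiM {..<k} (\<lambda>_. borel :: complex measure))"
      by (intro borel_measurable_sum measurable_component_singleton) auto
    note measurable_alive_past[OF U, of k, measurable]
    have "G \<in> borel_measurable (PiM {..<k} (\<lambda>_. borel) \<Otimes>\<^sub>M borel)"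
      unfolding G_def by measurable
    from rotation_past[OF this] have eq: "(\<integral>\<omega>. G (\<lambda>i\<in>{..<k}. xi i \<omega>, \<i> * xi k \<omega>) \<partial>M) = (\<integral>\<omega>. G (\<lambda>i\<in>{..<k}. xi i \<omega>, xi k \<omega>) \<partial>M)" .
    have G: "G (\<lambda>i\<in>{..<k}. xi i \<omega>, y) = ?I \<omega> *\<^sub>R \<Phi> (walk k \<omega> + w * y)" if "\<omega> \<in> space M" for \<omega> y
      unfolding G_def prod.case indicator_alive_past[OF that] walk_past[OF order_refl] ..
    have "E (\<i> * w) = (\<integral>\<omega>. G (\<lambda>i\<in>{..<k}. xi i \<omega>, \<i> * xi k \<omega>) \<partial>M)"
      unfolding E_def by (intro Bochner_Integration.integral_cong) (simp_all only: G, simp add: mult_ac)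
    also note eq
    also have "(\<integral>\<omega>. G (\<lambda>i\<in>{..<k}. xi i \<omega>, xi k \<omega>) \<partial>M) = E w"
      unfolding E_def by (intro Bochner_Integration.integral_cong) (simp_all only: G)
    finally show ?thesis .
  qed
  have E: "E \<i> = E 1" "E (- 1) = E 1" "E (- \<i>) = E 1"
    using rot[of 1] rot[of \<i>] rot[of "-1"] by simp_all
  let ?avg = "\<lambda>\<omega>. (\<Phi> (walk k \<omega> + xi k \<omega>) + \<Phi> (walk k \<omega> + \<i> * xi k \<omega>) + \<Phi> (walk k \<omega> - xi k \<omega>) + \<Phi> (walk k \<omega> - \<i> * xi k \<omega>)) / 4 - \<Phi> (walk k \<omega>)"
  have Ieq: "?I \<omega> *\<^sub>R ?avg \<omega> = (?I \<omega> *\<^sub>R \<Phi> (walk k \<omega> + 1 * xi k \<omega>) + ?I \<omega> *\<^sub>R \<Phi> (walk k \<omega> + \<i> * xi k \<omega>)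
      + ?I \<omega> *\<^sub>R \<Phi> (walk k \<omega> + - 1 * xi k \<omega>) + ?I \<omega> *\<^sub>R \<Phi> (walk k \<omega> + - \<i> * xi k \<omega>)) / 4 - ?I \<omega> *\<^sub>R \<Phi> (walk k \<omega>)" for \<omega>
      by (simp add: scaleR_conv_of_real algebra_simps add_divide_distrib)
  have Ii: "integrable M (\<lambda>\<omega>. ?I \<omega> *\<^sub>R \<Phi> (walk k \<omega> + w * xi k \<omega>))" "integrable M (\<lambda>\<omega>. ?I \<omega> *\<^sub>R \<Phi> (walk k \<omega>))" for w
      by (rule int, measurable)+
  have intA: "integrable M (\<lambda>\<omega>. ?I \<omega> *\<^sub>R ?avg \<omega>)"
    unfolding Ieq
    by (intro Bochner_Integration.integrable_diff Bochner_Integration.integrable_add integrable_divide Ii)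
  have "(\<integral>\<omega>. ?I \<omega> *\<^sub>R ?avg \<omega> \<partial>M) = (E 1 + E \<i> + E (- 1) + E (- \<i>)) / 4 - (\<integral>\<omega>. ?I \<omega> *\<^sub>R \<Phi> (walk k \<omega>) \<partial>M)"
  proof -
    show ?thesis unfolding Ieq E_def
      by (subst Bochner_Integration.integral_diff integral_divide_zero Bochner_Integration.integral_add;
          (intro Bochner_Integration.integrable_diff Bochner_Integration.integrable_add integrable_divide Ii)?)+ simp
  qed
  also have "\<dots> = E 1 - (\<integral>\<omega>. ?I \<omega> *\<^sub>R \<Phi> (walk k \<omega>) \<partial>M)" by (simp add: E)
  also have "\<dots> = (\<integral>\<omega>. ?I \<omega> *\<^sub>R (\<Phi> (walk (Suc k) \<omega>) - \<Phi> (walk k \<omega>)) \<partial>M)"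
    unfolding E_def scaleR_diff_right
    by (subst Bochner_Integration.integral_diff[symmetric]; (intro int)?; measurable?) (simp add: walk_def)
  finally have main: "(\<integral>\<omega>. ?I \<omega> *\<^sub>R ?avg \<omega> \<partial>M) = (\<integral>\<omega>. ?I \<omega> *\<^sub>R (\<Phi> (walk (Suc k) \<omega>) - \<Phi> (walk k \<omega>)) \<partial>M)" .
  have m2: "integrable M (\<lambda>\<omega>. ?I \<omega> * (cmod (xi k \<omega>))\<^sup>2)" "(\<integral>\<omega>. ?I \<omega> * (cmod (xi k \<omega>))\<^sup>2 \<partial>M) = prob (alive U k) * (2 * h)"
    using integral_alive_mult[OF U, of "\<lambda>y. (cmod y)\<^sup>2" k] second_moment[of k] by (auto simp: has_bochner_integral_iff)
  have m4: "integrable M (\<lambda>\<omega>. ?I \<omega> * (cmod (xi k \<omega>)) ^ 4)" "(\<integral>\<omega>. ?I \<omega> * (cmod (xi k \<omega>)) ^ 4 \<partial>M) = prob (alive U k) * (8 * h\<^sup>2)"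
    using integral_alive_mult[OF U, of "\<lambda>y. (cmod y) ^ 4" k] fourth_moment[of k] by (auto simp: has_bochner_integral_iff)
  have "(\<integral>\<omega>. ?I \<omega> *\<^sub>R ?avg \<omega> \<partial>M) - c * of_real (2 * h * prob (alive U k))
     = (\<integral>\<omega>. ?I \<omega> *\<^sub>R ?avg \<omega> \<partial>M) - (\<integral>\<omega>. c * complex_of_real (?I \<omega> * (cmod (xi k \<omega>))\<^sup>2) \<partial>M)"
    by (subst integral_mult_right_zero, subst integral_complex_of_real, subst m2(2)) (simp add: mult_ac)
  also have "\<dots> = (\<integral>\<omega>. ?I \<omega> *\<^sub>R ?avg \<omega> - c * complex_of_real (?I \<omega> * (cmod (xi k \<omega>))\<^sup>2) \<partial>M)"
    by (intro Bochner_Integration.integral_diff[symmetric] intA integrable_mult_right integrable_of_real m2)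
  finally have eq: "(\<integral>\<omega>. ?I \<omega> *\<^sub>R ?avg \<omega> \<partial>M) - c * of_real (2 * h * prob (alive U k)) = \<dots>" .
  have "cmod (\<integral>\<omega>. ?I \<omega> *\<^sub>R ?avg \<omega> - c * complex_of_real (?I \<omega> * (cmod (xi k \<omega>))\<^sup>2) \<partial>M)
     \<le> (\<integral>\<omega>. C * (?I \<omega> * (cmod (xi k \<omega>)) ^ 4) \<partial>M)"
  proof (rule order_trans[OF integral_norm_bound integral_mono])
    show "integrable M (\<lambda>\<omega>. cmod (?I \<omega> *\<^sub>R ?avg \<omega> - c * complex_of_real (?I \<omega> * (cmod (xi k \<omega>))\<^sup>2)))"
      by (intro integrable_norm Bochner_Integration.integrable_diff intA integrable_mult_right integrable_of_real m2)
    show "integrable M (\<lambda>\<omega>. C * (?I \<omega> * (cmod (xi k \<omega>)) ^ 4))"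
      by (intro integrable_mult_right m4)
    show "cmod (?I \<omega> *\<^sub>R ?avg \<omega> - c * complex_of_real (?I \<omega> * (cmod (xi k \<omega>))\<^sup>2)) \<le> C * (?I \<omega> * (cmod (xi k \<omega>)) ^ 4)" for \<omega>
      using avg[of "walk k \<omega>" "xi k \<omega>"] by (cases "\<omega> \<in> alive U k") (auto simp: alive_def)
  qed
  also have "\<dots> = 8 * C * h\<^sup>2 * prob (alive U k)"
    by (subst integral_mult_right_zero, subst m4(2)) simp
  finally show ?thesis using eq main by simp
qed

text \<open>The one-step estimates add up by telescoping; the sum of the probabilities is the
  expected number of steps taken among the first \<open>K\<close>.\<close>

lemma stopped_estimate:
  fixes \<Phi> :: "complex \<Rightarrow> complex"
  assumes U [measurable]: "U \<in> sets borel" and \<Phi> [measurable]: "\<Phi> \<in> borel_measurable borel"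
    and bound: "\<And>x. cmod (\<Phi> x) \<le> B"
    and avg: "\<And>x y. x \<in> U \<Longrightarrow> cmod ((\<Phi> (x + y) + \<Phi> (x + \<i> * y) + \<Phi> (x - y) + \<Phi> (x - \<i> * y)) / 4 - \<Phi> x
        - c * of_real ((cmod y)\<^sup>2)) \<le> C * cmod y ^ 4"
  shows "cmod ((\<integral>\<omega>. \<Phi> (stopped U K \<omega>) \<partial>M) - \<Phi> 0 - c * of_real (2 * h * (\<Sum>k<K. prob (alive U k))))
      \<le> 8 * C * h\<^sup>2 * (\<Sum>k<K. prob (alive U k))"
proof (induction K)
  case 0 then show ?case by (simp add: prob_space)
next
  case (Suc K)
  note measurable_stopped[OF U, measurable]
  have [measurable]: "alive U K \<in> events" using U by (rule sets_alive)
  let ?D = "\<lambda>\<omega>. indicat_real (alive U K) \<omega> *\<^sub>R (\<Phi> (walk (Suc K) \<omega>) - \<Phi> (walk K \<omega>))"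
  let ?p = "prob (alive U K)" let ?s = "\<Sum>k<K. prob (alive U k)"
  have i: "integrable M (\<lambda>\<omega>. \<Phi> (f \<omega>))" if [measurable]: "f \<in> borel_measurable M" for f
    by (rule integrable_const_bound[of _ B]) (use bound in auto)
  have "(\<integral>\<omega>. \<Phi> (stopped U (Suc K) \<omega>) \<partial>M) = (\<integral>\<omega>. \<Phi> (stopped U K \<omega>) + ?D \<omega> \<partial>M)"
    by (intro Bochner_Integration.integral_cong) (auto simp: stopped_alive)
  also have "\<dots> = (\<integral>\<omega>. \<Phi> (stopped U K \<omega>) \<partial>M) + (\<integral>\<omega>. ?D \<omega> \<partial>M)"
    by (intro Bochner_Integration.integral_add i integrable_mult_indicator Bochner_Integration.integrable_diff) measurable
  finally have "(\<integral>\<omega>. \<Phi> (stopped U (Suc K) \<omega>) \<partial>M) - \<Phi> 0 - c * of_real (2 * h * (\<Sum>k<Suc K. prob (alive U k)))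
    = ((\<integral>\<omega>. \<Phi> (stopped U K \<omega>) \<partial>M) - \<Phi> 0 - c * of_real (2 * h * ?s)) + ((\<integral>\<omega>. ?D \<omega> \<partial>M) - c * of_real (2 * h * ?p))"
    by (simp add: algebra_simps)
  also have "cmod \<dots> \<le> 8 * C * h\<^sup>2 * ?s + 8 * C * h\<^sup>2 * ?p"
    by (intro order_trans[OF norm_triangle_ineq] add_mono Suc.IH one_step[OF U \<Phi> bound avg])
  finally show ?case by (simp add: algebra_simps)
qed

end

text \<open>The cutoff makes the square bounded on the whole plane. If
  \<open>cmod y \<le> 1\<close>, none of the four points is cut off and the parallelogram identity
  gives error 0; for longer steps the error is at most
  \<open>(R + 1)\<^sup>2 + (cmod y)\<^sup>2\<close>, and \<open>cmod y ^ 4\<close> dominates both 1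
  and \<open>(cmod y)\<^sup>2\<close>.\<close>

lemma truncated_square_average:
  fixes \<Phi> R defines "\<Phi> \<equiv> \<lambda>x. if cmod x \<le> R + 1 then complex_of_real ((cmod x)\<^sup>2) else 0"
  assumes x: "cmod x \<le> R"
  shows "cmod ((\<Phi> (x + y) + \<Phi> (x + \<i> * y) + \<Phi> (x - y) + \<Phi> (x - \<i> * y)) / 4 - \<Phi> x
        - 1 * of_real ((cmod y)\<^sup>2)) \<le> ((R + 1)\<^sup>2 + 1) * cmod y ^ 4"
proof -
  define f where "f z = (if cmod z \<le> R + 1 then (cmod z)\<^sup>2 else 0)" for z
  have f: "0 \<le> f z" "f z \<le> (R + 1)\<^sup>2" for z
    using power_mono[of "cmod z" "R + 1" 2] by (auto simp: f_def)
  have "\<Phi> z = of_real (f z)" for z by (simp add: \<Phi>_def f_def)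
  then have "cmod ((\<Phi> (x + y) + \<Phi> (x + \<i> * y) + \<Phi> (x - y) + \<Phi> (x - \<i> * y)) / 4 - \<Phi> x - 1 * of_real ((cmod y)\<^sup>2))
     = cmod (of_real ((f (x + y) + f (x + \<i> * y) + f (x - y) + f (x - \<i> * y)) / 4 - f x - (cmod y)\<^sup>2))"
    by simp
  also have "\<dots> = \<bar>(f (x + y) + f (x + \<i> * y) + f (x - y) + f (x - \<i> * y)) / 4 - f x - (cmod y)\<^sup>2\<bar>"
    by (rule norm_of_real)
  also have "\<dots> \<le> ((R + 1)\<^sup>2 + 1) * cmod y ^ 4"
  proof (cases "cmod y \<le> 1")
    case True
    have "cmod (x + y) \<le> R + 1" "cmod (x + \<i> * y) \<le> R + 1" "cmod (x - y) \<le> R + 1" "cmod (x - \<i> * y) \<le> R + 1"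
      using x True norm_triangle_ineq[of x y] norm_triangle_ineq[of x "\<i> * y"] norm_triangle_ineq4[of x y]
        norm_triangle_ineq4[of x "\<i> * y"] by (auto simp: norm_mult)
    then have "(f (x + y) + f (x + \<i> * y) + f (x - y) + f (x - \<i> * y)) / 4 - f x - (cmod y)\<^sup>2 = 0"
      using x by (simp add: f_def cmod_power2) (simp add: power2_eq_square algebra_simps)
    then show ?thesis by simp
  next
    case False
    then have y: "1 \<le> cmod y ^ 4" "(cmod y)\<^sup>2 \<le> cmod y ^ 4" by (auto intro: power_increasing)
    define A where "A = (f (x + y) + f (x + \<i> * y) + f (x - y) + f (x - \<i> * y)) / 4"
    have A: "0 \<le> A" "A \<le> (R + 1)\<^sup>2"
      using f[of "x + y"] f[of "x + \<i> * y"] f[of "x - y"] f[of "x - \<i> * y"] by (simp_all add: A_def)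
    have "\<bar>(f (x + y) + f (x + \<i> * y) + f (x - y) + f (x - \<i> * y)) / 4 - f x - (cmod y)\<^sup>2\<bar> \<le> (R + 1)\<^sup>2 + (cmod y)\<^sup>2"
      unfolding A_def[symmetric] using A f[of x] zero_le_power2[of "cmod y"] by linarith
    also have "\<dots> \<le> (R + 1)\<^sup>2 * cmod y ^ 4 + cmod y ^ 4"
      using y mult_left_mono[of 1 "cmod y ^ 4" "(R + 1)\<^sup>2"] by simp
    finally show ?thesis by (simp add: algebra_simps)
  qed
  finally show ?thesis .
qed

section \<open>Exit of the walk from a bounded set\<close>

context planar_walk begin

definition exit_step :: "complex set \<Rightarrow> 'a \<Rightarrow> nat" where
  "exit_step U \<omega> = (LEAST k. walk k \<omega> \<notin> U)"

lemma alive_iff_less_exit_step: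
  assumes "\<omega> \<in> space M" "\<exists>k. walk k \<omega> \<notin> U"
  shows "\<omega> \<in> alive U k \<longleftrightarrow> k < exit_step U \<omega>"
proof -
  have "walk (exit_step U \<omega>) \<omega> \<notin> U"
    unfolding exit_step_def using assms(2) by (rule LeastI_ex)
  moreover have "walk j \<omega> \<in> U" if "j < exit_step U \<omega>" for j
    using not_less_Least that unfolding exit_step_def by blast
  ultimately show ?thesis
    using assms(1) unfolding alive_def by (auto simp: not_le[symmetric])
qed

lemma stopped_eventually:
  assumes "\<omega> \<in> space M" "\<exists>k. walk k \<omega> \<notin> U" "exit_step U \<omega> \<le> K"
  shows "stopped U K \<omega> = walk (exit_step U \<omega>) \<omega>"
  using assms(3)
proof (induction K)
  case 0 then show ?case by (simp add: walk_def)
next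
  case (Suc K)
  then show ?case
    using alive_iff_less_exit_step[OF assms(1,2), of K] by (cases "exit_step U \<omega> \<le> K") (auto simp: le_Suc_eq)
qed

lemma measurable_exit_step:
  assumes "U \<in> sets borel"
  shows "exit_step U \<in> M \<rightarrow>\<^sub>M count_space UNIV"
  unfolding exit_step_def [abs_def] using assms by measurable

lemma measurable_exit_position:
  assumes "U \<in> sets borel"
  shows "(\<lambda>\<omega>. walk (exit_step U \<omega>) \<omega>) \<in> borel_measurable M"
  by (rule measurable_compose_countable[OF measurable_walk measurable_exit_step[OF assms]])

text \<open>The truncated square has expectation at most \<open>(R + 1)\<^sup>2\<close>, while each
  step taken adds \<open>2 * h\<close> up to an error that \<open>small\<close> keeps below
  \<open>h\<close>. At least \<open>h\<close> per step survives, which gives a bound independent of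
  \<open>K\<close> and \<open>h\<close>.\<close>

lemma sum_alive_le:
  assumes U: "U \<in> sets borel" and R: "\<And>x. x \<in> U \<Longrightarrow> cmod x \<le> R" "0 \<le> R"
    and small: "8 * ((R + 1)\<^sup>2 + 1) * h \<le> 1"
  shows "h * (\<Sum>k<K. prob (alive U k)) \<le> (R + 1)\<^sup>2"
proof -
  let ?C = "(R + 1)\<^sup>2 + 1" let ?s = "\<Sum>k<K. prob (alive U k)"
  define \<Phi> where "\<Phi> x = (if cmod x \<le> R + 1 then complex_of_real ((cmod x)\<^sup>2) else 0)" for x
  have [measurable]: "\<Phi> \<in> borel_measurable borel" unfolding \<Phi>_def [abs_def] by measurable
  note measurable_stopped[OF U, measurable]
  have b: "cmod (\<Phi> x) \<le> (R + 1)\<^sup>2" for x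
    by (auto simp: \<Phi>_def norm_power power_mono)
  have s: "0 \<le> ?s" by (intro sum_nonneg) auto
  have est: "cmod ((\<integral>\<omega>. \<Phi> (stopped U K \<omega>) \<partial>M) - \<Phi> 0 - 1 * of_real (2 * h * ?s)) \<le> 8 * ?C * h\<^sup>2 * ?s"
    by (rule stopped_estimate[OF U _ b]) (simp, unfold \<Phi>_def, rule truncated_square_average[OF R(1)])
  have "cmod (\<integral>\<omega>. \<Phi> (stopped U K \<omega>) \<partial>M) \<le> (\<integral>\<omega>. (R + 1)\<^sup>2 \<partial>M)"
    by (rule order_trans[OF integral_norm_bound integral_mono])
       (auto simp: b intro!: integrable_norm integrable_const_bound[of _ "(R + 1)\<^sup>2"])
  then have "cmod (\<integral>\<omega>. \<Phi> (stopped U K \<omega>) \<partial>M) \<le> (R + 1)\<^sup>2" by (simp add: prob_space)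
  moreover have "2 * h * ?s = cmod (of_real (2 * h * ?s))"
    unfolding norm_of_real using h_pos s by simp
  moreover have "cmod (of_real (2 * h * ?s)) \<le> cmod (\<integral>\<omega>. \<Phi> (stopped U K \<omega>) \<partial>M) + cmod ((\<integral>\<omega>. \<Phi> (stopped U K \<omega>) \<partial>M) - of_real (2 * h * ?s))"
    by (metis norm_triangle_sub norm_minus_commute)
  moreover have "\<Phi> 0 = 0" by (simp add: \<Phi>_def)
  moreover have "8 * ?C * h\<^sup>2 * ?s \<le> h * ?s"
    using mult_right_mono[OF small, of "h * ?s"] h_pos s by (simp add: power2_eq_square mult_ac)
  ultimately show ?thesis using est by simp
qed

context
  fixes U R
  assumes U: "U \<in> sets borel" and R: "\<And>x. x \<in> U \<Longrightarrow> cmod x \<le> R" "0 \<le> R"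
    and small: "8 * ((R + 1)\<^sup>2 + 1) * h \<le> 1"
begin

lemma summable_alive: "summable (\<lambda>k. prob (alive U k))"
proof (rule summableI_nonneg_bounded)
  show "(\<Sum>k<K. prob (alive U k)) \<le> (R + 1)\<^sup>2 / h" for K
    using sum_alive_le[OF U R small, of K] h_pos by (simp add: field_simps)
qed auto

text \<open>A path that never leaves \<open>U\<close> is alive at every index, and the probabilities
  of being alive tend to 0 because they are summable.\<close>

lemma AE_exit: "AE \<omega> in M. \<exists>k. walk k \<omega> \<notin> U"
proof -
  let ?A = "{\<omega> \<in> space M. \<forall>k. walk k \<omega> \<in> U}"
  have [measurable]: "U \<in> sets borel" by (rule U)
  have A: "?A \<in> events" by measurable
  have "prob ?A \<le> prob (alive U k)" for k
    by (intro finite_measure_mono sets_alive U) (auto simp: alive_def)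
  then have "prob ?A \<le> 0"
    by (intro LIMSEQ_le_const[OF summable_LIMSEQ_zero[OF summable_alive]]) auto
  then have "AE \<omega> in M. \<omega> \<notin> ?A"
    using A by (intro AE_not_in) (auto simp: null_sets_def emeasure_eq_measure measure_le_0_iff)
  with AE_space show ?thesis by eventually_elim auto
qed

text \<open>Tail-sum formula: on a path that leaves \<open>U\<close>, the exit step counts the
  indices at which the path is alive.\<close>

lemma expectation_exit_step:
  "has_bochner_integral M (\<lambda>\<omega>. real (exit_step U \<omega>)) (\<Sum>k. prob (alive U k))"
proof (rule has_bochner_integral_nn_integral)
  note measurable_exit_step[OF U, measurable]
  show "(\<lambda>\<omega>. real (exit_step U \<omega>)) \<in> borel_measurable M" by measurable
  have "(\<integral>\<^sup>+\<omega>. ennreal (real (exit_step U \<omega>)) \<partial>M) = (\<integral>\<^sup>+\<omega>. (\<Sum>k. indicator (alive U k) \<omega>) \<partial>M)"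
  proof (rule nn_integral_cong_AE)
    show "AE \<omega> in M. ennreal (real (exit_step U \<omega>)) = (\<Sum>k. indicator (alive U k) \<omega>)"
      using AE_exit AE_space
    proof eventually_elim
      case (elim \<omega>)
      have "(\<Sum>k. indicator (alive U k) \<omega> :: ennreal) = (\<Sum>k<exit_step U \<omega>. indicator (alive U k) \<omega>)"
        using alive_iff_less_exit_step[OF elim(2,1)] by (intro suminf_finite) auto
      also have "\<dots> = (\<Sum>k<exit_step U \<omega>. 1)"
        using alive_iff_less_exit_step[OF elim(2,1)] by (intro sum.cong) auto
      finally show ?case by (simp add: ennreal_of_nat_eq_real_of_nat)
    qed
  qed
  also have "\<dots> = (\<Sum>k. emeasure M (alive U k))"
    using sets_alive[OF U] by (subst nn_integral_suminf) auto
  also have "\<dots> = ennreal (\<Sum>k. prob (alive U k))"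
    using summable_alive by (simp add: emeasure_eq_measure suminf_ennreal2)
  finally show "(\<integral>\<^sup>+\<omega>. ennreal (real (exit_step U \<omega>)) \<partial>M) = ennreal (\<Sum>k. prob (alive U k))" .
qed (auto intro: suminf_nonneg summable_alive)

text \<open>Limit of \<open>stopped_estimate\<close> as \<open>K\<close> grows: on almost every path
  the stopped walk is eventually constant, and \<open>B\<close> dominates.\<close>

lemma exit_estimate:
  fixes \<Phi> :: "complex \<Rightarrow> complex"
  assumes \<Phi> [measurable]: "\<Phi> \<in> borel_measurable borel"
    and bound: "\<And>x. cmod (\<Phi> x) \<le> B"
    and avg: "\<And>x y. x \<in> U \<Longrightarrow> cmod ((\<Phi> (x + y) + \<Phi> (x + \<i> * y) + \<Phi> (x - y) + \<Phi> (x - \<i> * y)) / 4 - \<Phi> x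
        - c * of_real ((cmod y)\<^sup>2)) \<le> C * cmod y ^ 4"
  shows "cmod ((\<integral>\<omega>. \<Phi> (walk (exit_step U \<omega>) \<omega>) \<partial>M) - \<Phi> 0 - c * of_real (2 * (\<integral>\<omega>. h * real (exit_step U \<omega>) \<partial>M)))
      \<le> 8 * C * h * (\<integral>\<omega>. h * real (exit_step U \<omega>) \<partial>M)"
proof -
  note measurable_stopped[OF U, measurable] measurable_exit_position[OF U, measurable]
  have E: "(\<integral>\<omega>. h * real (exit_step U \<omega>) \<partial>M) = h * (\<Sum>k. prob (alive U k))"
    using has_bochner_integral_integral_eq[OF expectation_exit_step] by simp
  have lim: "(\<lambda>K. \<Sum>k<K. prob (alive U k)) \<longlonglongrightarrow> (\<Sum>k. prob (alive U k))"
    by (rule summable_LIMSEQ[OF summable_alive])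
  have "(\<lambda>K. \<integral>\<omega>. \<Phi> (stopped U K \<omega>) \<partial>M) \<longlonglongrightarrow> (\<integral>\<omega>. \<Phi> (walk (exit_step U \<omega>) \<omega>) \<partial>M)"
  proof (rule integral_dominated_convergence[where w = "\<lambda>_. B"])
    show "AE \<omega> in M. (\<lambda>K. \<Phi> (stopped U K \<omega>)) \<longlonglongrightarrow> \<Phi> (walk (exit_step U \<omega>) \<omega>)"
      using AE_exit AE_space
    proof eventually_elim
      case (elim \<omega>)
      have "eventually (\<lambda>K. \<Phi> (stopped U K \<omega>) = \<Phi> (walk (exit_step U \<omega>) \<omega>)) sequentially"
        using stopped_eventually[OF elim(2,1)] by (intro eventually_sequentiallyI[of "exit_step U \<omega>"]) simp
      then show ?case by (rule tendsto_eventually)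
    qed
  qed (use bound in auto)
  then have "(\<lambda>K. cmod ((\<integral>\<omega>. \<Phi> (stopped U K \<omega>) \<partial>M) - \<Phi> 0 - c * of_real (2 * h * (\<Sum>k<K. prob (alive U k))))) \<longlonglongrightarrow>
     cmod ((\<integral>\<omega>. \<Phi> (walk (exit_step U \<omega>) \<omega>) \<partial>M) - \<Phi> 0 - c * of_real (2 * h * (\<Sum>k. prob (alive U k))))"
    by (intro tendsto_intros lim)
  moreover have "(\<lambda>K. 8 * C * h\<^sup>2 * (\<Sum>k<K. prob (alive U k))) \<longlonglongrightarrow> 8 * C * h\<^sup>2 * (\<Sum>k. prob (alive U k))"
    by (intro tendsto_intros lim)
  ultimately have "cmod ((\<integral>\<omega>. \<Phi> (walk (exit_step U \<omega>) \<omega>) \<partial>M) - \<Phi> 0 - c * of_real (2 * h * (\<Sum>k. prob (alive U k))))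
      \<le> 8 * C * h\<^sup>2 * (\<Sum>k. prob (alive U k))"
    by (rule LIMSEQ_le) (use stopped_estimate[OF U \<Phi> bound avg] in auto)
  then show ?thesis unfolding E by (simp add: power2_eq_square mult_ac)
qed

end

end

section \<open>Planar Brownian motion on a grid\<close>

text \<open>A quarter turn exchanges the two coordinates, so independence is wanted in the other
  order too.\<close>

lemma (in prob_space) indep_var_swap:
  assumes "indep_var S X T Y"
  shows "indep_var T Y S X"
proof -
  have X [measurable]: "random_variable S X" and Y [measurable]: "random_variable T Y"
    and eq: "distr M S X \<Otimes>\<^sub>M distr M T Y = distr M (S \<Otimes>\<^sub>M T) (\<lambda>x. (X x, Y x))"
    using assms by (auto simp: indep_var_distribution_eq)
  interpret X: prob_space "distr M S X" by (rule prob_space_distr) fact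
  interpret Y: prob_space "distr M T Y" by (rule prob_space_distr) fact
  interpret YX: pair_prob_space "distr M T Y" "distr M S X" ..
  have "distr M T Y \<Otimes>\<^sub>M distr M S X = distr (distr M S X \<Otimes>\<^sub>M distr M T Y) (distr M T Y \<Otimes>\<^sub>M distr M S X) (\<lambda>(x, y). (y, x))"
    by (rule YX.distr_pair_swap)
  also have "\<dots> = distr (distr M (S \<Otimes>\<^sub>M T) (\<lambda>x. (X x, Y x))) (T \<Otimes>\<^sub>M S) (\<lambda>(x, y). (y, x))"
    unfolding eq by (rule distr_cong) (auto intro!: sets_pair_measure_cong)
  also have "\<dots> = distr M (T \<Otimes>\<^sub>M S) (\<lambda>x. (Y x, X x))"
    by (subst distr_distr[OF measurable_pair_swap']) (simp_all add: comp_def)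
  finally show ?thesis using X Y by (simp add: indep_var_distribution_eq)
qed

text \<open>Rectangles form an intersection-stable generator of the product sigma-algebra. On them
  the probability splits first between the two families and then inside each family.\<close>

lemma (in prob_space) indep_vars_Pair:
  fixes a b :: "'i \<Rightarrow> 'a \<Rightarrow> real"
  assumes I: "finite I" "I \<noteq> {}"
    and a: "indep_vars (\<lambda>_. borel) a I" and b: "indep_vars (\<lambda>_. borel) b I"
    and ab: "indep_var (PiM I (\<lambda>_. borel)) (\<lambda>\<omega>. \<lambda>i\<in>I. a i \<omega>) (PiM I (\<lambda>_. borel)) (\<lambda>\<omega>. \<lambda>i\<in>I. b i \<omega>)"
  shows "indep_vars (\<lambda>_. borel \<Otimes>\<^sub>M borel) (\<lambda>i \<omega>. (a i \<omega>, b i \<omega>)) I"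
proof -
  let ?E = "{A \<times> B | A B. A \<in> sets (borel :: real measure) \<and> B \<in> sets (borel :: real measure)}"
  have ma: "i \<in> I \<Longrightarrow> random_variable borel (a i)" and mb: "i \<in> I \<Longrightarrow> random_variable borel (b i)" for i
    using a b by (auto simp: indep_vars_def)
  \<comment> \<open>Applied with \<open>J = I\<close> to split the whole intersection and with
    singletons to recombine the factors. The sets are padded with \<open>UNIV\<close> outside
    \<open>J\<close> to obtain boxes over all of \<open>I\<close>.\<close>
  have ev: "prob (\<Inter>i\<in>J. (\<lambda>\<omega>. (a i \<omega>, b i \<omega>)) -` (A i \<times> B i) \<inter> space M) =
     (\<Prod>i\<in>J. prob (a i -` A i \<inter> space M)) * (\<Prod>i\<in>J. prob (b i -` B i \<inter> space M))"
    if J: "J \<subseteq> I" "J \<noteq> {}" and AB: "\<And>i. i \<in> J \<Longrightarrow> A i \<in> sets borel" "\<And>i. i \<in> J \<Longrightarrow> B i \<in> sets borel" for J A B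
  proof -
    have fJ: "finite J" using J I finite_subset by blast
    define A' B' where "A' i = (if i \<in> J then A i else UNIV)" and "B' i = (if i \<in> J then B i else UNIV)" for i
    have "prob ((\<lambda>\<omega>. (\<lambda>i\<in>I. a i \<omega>, \<lambda>i\<in>I. b i \<omega>)) -` (PiE I A' \<times> PiE I B') \<inter> space M) =
        prob ((\<lambda>\<omega>. \<lambda>i\<in>I. a i \<omega>) -` PiE I A' \<inter> space M) * prob ((\<lambda>\<omega>. \<lambda>i\<in>I. b i \<omega>) -` PiE I B' \<inter> space M)"
      using AB I by (intro indep_varD[OF ab] sets_PiM_I_finite) (auto simp: A'_def B'_def)
    moreover have "(\<lambda>\<omega>. (\<lambda>i\<in>I. a i \<omega>, \<lambda>i\<in>I. b i \<omega>)) -` (PiE I A' \<times> PiE I B') \<inter> space M =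
        (\<Inter>i\<in>J. (\<lambda>\<omega>. (a i \<omega>, b i \<omega>)) -` (A i \<times> B i) \<inter> space M)"
      using J unfolding A'_def B'_def by (auto simp: PiE_iff split: if_splits; blast)
    moreover have "(\<lambda>\<omega>. \<lambda>i\<in>I. a i \<omega>) -` PiE I A' \<inter> space M = (\<Inter>i\<in>J. a i -` A i \<inter> space M)"
      using J unfolding A'_def by (auto simp: PiE_iff split: if_splits; blast)
    moreover have "(\<lambda>\<omega>. \<lambda>i\<in>I. b i \<omega>) -` PiE I B' \<inter> space M = (\<Inter>i\<in>J. b i -` B i \<inter> space M)"
      using J unfolding B'_def by (auto simp: PiE_iff split: if_splits; blast)
    moreover have "prob (\<Inter>i\<in>J. a i -` A i \<inter> space M) = (\<Prod>i\<in>J. prob (a i -` A i \<inter> space M))"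
      "prob (\<Inter>i\<in>J. b i -` B i \<inter> space M) = (\<Prod>i\<in>J. prob (b i -` B i \<inter> space M))"
      using indep_varsD[OF a J(2) fJ J(1)] indep_varsD[OF b J(2) fJ J(1)] AB by blast+
    ultimately show ?thesis by simp
  qed
  show ?thesis
  proof (subst indep_vars_finite[where E = "\<lambda>_. ?E"])
    show "\<forall>F\<in>I \<rightarrow> ?E. prob (\<Inter>j\<in>I. (\<lambda>\<omega>. (a j \<omega>, b j \<omega>)) -` F j \<inter> space M) =
       (\<Prod>j\<in>I. prob ((\<lambda>\<omega>. (a j \<omega>, b j \<omega>)) -` F j \<inter> space M))"
    proof
      fix F assume "F \<in> I \<rightarrow> ?E"
      then have "\<forall>i\<in>I. \<exists>A B. F i = A \<times> B \<and> A \<in> sets borel \<and> B \<in> sets borel" by blast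
      then obtain A B where F: "\<And>i. i \<in> I \<Longrightarrow> F i = A i \<times> B i \<and> A i \<in> sets borel \<and> B i \<in> sets borel"
        by metis
      have "prob (\<Inter>j\<in>I. (\<lambda>\<omega>. (a j \<omega>, b j \<omega>)) -` F j \<inter> space M) =
         prob (\<Inter>j\<in>I. (\<lambda>\<omega>. (a j \<omega>, b j \<omega>)) -` (A j \<times> B j) \<inter> space M)"
        using F by (intro arg_cong[where f = prob] INF_cong) auto
      also have "\<dots> = (\<Prod>i\<in>I. prob (a i -` A i \<inter> space M) * prob (b i -` B i \<inter> space M))"
        unfolding prod.distrib using F I by (intro ev) auto
      also have "\<dots> = (\<Prod>j\<in>I. prob ((\<lambda>\<omega>. (a j \<omega>, b j \<omega>)) -` F j \<inter> space M))"
      proof (intro prod.cong refl)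
        fix j assume j: "j \<in> I"
        show "prob (a j -` A j \<inter> space M) * prob (b j -` B j \<inter> space M) = prob ((\<lambda>\<omega>. (a j \<omega>, b j \<omega>)) -` F j \<inter> space M)"
          using ev[of "{j}" A B] j F[OF j] by simp
      qed
      finally show "prob (\<Inter>j\<in>I. (\<lambda>\<omega>. (a j \<omega>, b j \<omega>)) -` F j \<inter> space M) =
       (\<Prod>j\<in>I. prob ((\<lambda>\<omega>. (a j \<omega>, b j \<omega>)) -` F j \<inter> space M))" .
    qed
  qed (use I ma mb Int_stable_pair_measure_generator[of borel borel] in
      \<open>auto simp: sets_pair_measure space_pair_measure intro!: exI[of _ UNIV]\<close>)
qed

text \<open>Each coordinate has second moment \<open>h\<close> and fourth moment
  \<open>3 * h\<^sup>2\<close>; with the mixed term \<open>2 * (h * h)\<close> the total is the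
  \<open>8 * h\<^sup>2\<close> of \<open>planar_walk\<close>.\<close>

lemma (in prob_space) gaussian_pair_moments:
  fixes a b :: "'a \<Rightarrow> real"
  assumes h: "0 < h" and da: "distributed M lborel a (normal_density 0 (sqrt h))"
    and db: "distributed M lborel b (normal_density 0 (sqrt h))" and ind: "indep_var borel a borel b"
  shows "has_bochner_integral M (\<lambda>\<omega>. (a \<omega>)\<^sup>2 + (b \<omega>)\<^sup>2) (2 * h)"
    "has_bochner_integral M (\<lambda>\<omega>. ((a \<omega>)\<^sup>2 + (b \<omega>)\<^sup>2)\<^sup>2) (8 * h\<^sup>2)"
proof -
  have mom: "has_bochner_integral M (\<lambda>\<omega>. X \<omega> ^ (2 * k)) (fact (2 * k) / ((2 / h) ^ k * fact k))"
    if X: "distributed M lborel X (normal_density 0 (sqrt h))" for X k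
  proof -
    have "has_bochner_integral lborel (\<lambda>x. normal_density 0 (sqrt h) x * x ^ (2 * k)) (fact (2 * k) / ((2 / h) ^ k * fact k))"
      using normal_moment_even[of "sqrt h" 0 k] h by simp
    then show ?thesis
      using distributed_integrable[OF X, of "\<lambda>x. x ^ (2 * k)"] distributed_integral[OF X, of "\<lambda>x. x ^ (2 * k)"]
      by (simp add: has_bochner_integral_iff)
  qed
  have a2: "has_bochner_integral M (\<lambda>\<omega>. (a \<omega>)\<^sup>2) h" and b2: "has_bochner_integral M (\<lambda>\<omega>. (b \<omega>)\<^sup>2) h"
    using mom[OF da, of 1] mom[OF db, of 1] h by (simp_all add: fact_numeral)
  have a4: "has_bochner_integral M (\<lambda>\<omega>. (a \<omega>) ^ 4) (3 * h\<^sup>2)" and b4: "has_bochner_integral M (\<lambda>\<omega>. (b \<omega>) ^ 4) (3 * h\<^sup>2)"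
    using mom[OF da, of 2] mom[OF db, of 2] h by (simp_all add: fact_numeral power2_eq_square field_simps)
  have "indep_var borel (\<lambda>\<omega>. (a \<omega>)\<^sup>2) borel (\<lambda>\<omega>. (b \<omega>)\<^sup>2)"
    using indep_var_compose[OF ind, of "\<lambda>x. x\<^sup>2" borel "\<lambda>x. x\<^sup>2" borel] by (simp add: comp_def)
  then have ab: "has_bochner_integral M (\<lambda>\<omega>. (a \<omega>)\<^sup>2 * (b \<omega>)\<^sup>2) (h * h)"
    using a2 b2 by (simp add: has_bochner_integral_iff indep_var_lebesgue_integral indep_var_integrable)
  show "has_bochner_integral M (\<lambda>\<omega>. (a \<omega>)\<^sup>2 + (b \<omega>)\<^sup>2) (2 * h)"
    using has_bochner_integral_add[OF a2 b2] by simp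
  have "has_bochner_integral M (\<lambda>\<omega>. (a \<omega>) ^ 4 + 2 * ((a \<omega>)\<^sup>2 * (b \<omega>)\<^sup>2) + (b \<omega>) ^ 4) (3 * h\<^sup>2 + 2 * (h * h) + 3 * h\<^sup>2)"
    by (intro has_bochner_integral_add has_bochner_integral_mult_right a4 b4 ab)
  then show "has_bochner_integral M (\<lambda>\<omega>. ((a \<omega>)\<^sup>2 + (b \<omega>)\<^sup>2)\<^sup>2) (8 * h\<^sup>2)"
    by (rule has_bochner_integral_cong[THEN iffD1, rotated -1]) (auto simp: power2_eq_square eval_nat_numeral algebra_simps)
qed

lemma borel_measurable_Complex: "(\<lambda>(x, y). Complex x y) \<in> borel_measurable (borel \<Otimes>\<^sub>M borel)"
  by (subst borel_measurable_complex_iff) (auto simp: split_beta')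

text \<open>Multiplication by \<open>\<i>\<close> sends \<open>(a, b)\<close> to
  \<open>(- b, a)\<close>, which is again an independent pair of centred Gaussians of variance
  \<open>h\<close> and so has the same joint law.\<close>

lemma (in prob_space) gaussian_pair_rotation:
  fixes a b :: "'a \<Rightarrow> real"
  assumes h: "0 < h" and da: "distributed M lborel a (normal_density 0 (sqrt h))"
    and db: "distributed M lborel b (normal_density 0 (sqrt h))" and ind: "indep_var borel a borel b"
  shows "distr M borel (\<lambda>\<omega>. \<i> * Complex (a \<omega>) (b \<omega>)) = distr M borel (\<lambda>\<omega>. Complex (a \<omega>) (b \<omega>))"
proof -
  let ?N = "density lborel (normal_density 0 (sqrt h))"
  have law: "distr M borel X = ?N" if "distributed M lborel X (normal_density 0 (sqrt h))" for X
    using that by (auto simp: distributed_def cong: distr_cong intro: trans[rotated])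
  have Ma: "distributed M lborel (\<lambda>\<omega>. - b \<omega>) (normal_density 0 (sqrt h))"
    using normal_density_affine[OF db, of "-1" 0] h by simp
  have pair: "distr M borel (\<lambda>\<omega>. Complex (X \<omega>) (Y \<omega>)) = distr (?N \<Otimes>\<^sub>M ?N) borel (\<lambda>(x, y). Complex x y)"
    if X: "distributed M lborel X (normal_density 0 (sqrt h))" and Y: "distributed M lborel Y (normal_density 0 (sqrt h))"
      and XY: "indep_var borel X borel Y" for X Y
  proof -
    have "distr M borel (\<lambda>\<omega>. Complex (X \<omega>) (Y \<omega>)) =
       distr (distr M (borel \<Otimes>\<^sub>M borel) (\<lambda>\<omega>. (X \<omega>, Y \<omega>))) borel (\<lambda>(x, y). Complex x y)"
      using indep_var_rv1[OF XY] indep_var_rv2[OF XY]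
      by (subst distr_distr[OF borel_measurable_Complex]) (simp_all add: comp_def)
    also have "distr M (borel \<Otimes>\<^sub>M borel) (\<lambda>\<omega>. (X \<omega>, Y \<omega>)) = ?N \<Otimes>\<^sub>M ?N"
      using XY law[OF X] law[OF Y] unfolding indep_var_distribution_eq by simp
    finally show ?thesis .
  qed
  have "indep_var borel (\<lambda>\<omega>. - b \<omega>) borel a"
    using indep_var_compose[OF indep_var_swap[OF ind], of uminus borel "\<lambda>x. x" borel] by (simp add: comp_def)
  from pair[OF Ma da this] pair[OF da db ind]
  have "distr M borel (\<lambda>\<omega>. Complex (- b \<omega>) (a \<omega>)) = distr M borel (\<lambda>\<omega>. Complex (a \<omega>) (b \<omega>))" by simp
  also have "distr M borel (\<lambda>\<omega>. Complex (- b \<omega>) (a \<omega>)) = distr M borel (\<lambda>\<omega>. \<i> * Complex (a \<omega>) (b \<omega>))"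
    by (rule distr_cong) (auto simp: complex_eq_iff)
  finally show ?thesis .
qed

lemma standard_brownian_motion_increments:
  assumes "standard_brownian_motion M B" and "0 \<le> t 0" "\<forall>i<k. t i \<le> t (Suc i)"
  shows "prob_space.indep_vars M (\<lambda>_. borel) (\<lambda>i \<omega>. B (t (Suc i)) \<omega> - B (t i) \<omega>) {..<k}"
proof -
  have "\<forall>(k::nat) (t::nat \<Rightarrow> real). 0 \<le> t 0 \<longrightarrow> (\<forall>i<k. t i \<le> t (Suc i)) \<longrightarrow>
        prob_space.indep_vars M (\<lambda>_. borel) (\<lambda>i \<omega>. B (t (Suc i)) \<omega> - B (t i) \<omega>) {..<k}"
    using assms(1) unfolding standard_brownian_motion_def by (elim conjE)
  from this[THEN spec, THEN spec, THEN mp, THEN mp, OF assms(2,3)] show ?thesis .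
qed

text \<open>Independence of the planar increments combines independence over time within each
  coordinate with independence of the coordinates. The latter is applied to whole vectors of
  increments, which is why it is assumed for the processes.\<close>

lemma planar_brownian_motion_walk:
  assumes W: "planar_brownian_motion M W" and h: "0 < h"
  shows "planar_walk M (\<lambda>k \<omega>. W (real (Suc k) * h) \<omega> - W (real k * h) \<omega>) h"
proof -
  let ?t = "\<lambda>k. real k * h"
  define a where "a k \<omega> = Re (W (?t (Suc k)) \<omega>) - Re (W (?t k) \<omega>)" for k \<omega>
  define b where "b k \<omega> = Im (W (?t (Suc k)) \<omega>) - Im (W (?t k) \<omega>)" for k \<omega>
  from W have BR: "standard_brownian_motion M (\<lambda>t \<omega>. Re (W t \<omega>))"
    and BI: "standard_brownian_motion M (\<lambda>t \<omega>. Im (W t \<omega>))"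
    and ind: "prob_space.indep_var M
       (PiM {0..} (\<lambda>_. borel)) (\<lambda>\<omega>. \<lambda>t\<in>{0..}. Re (W t \<omega>))
       (PiM {0..} (\<lambda>_. borel)) (\<lambda>\<omega>. \<lambda>t\<in>{0..}. Im (W t \<omega>))"
    by (auto simp: planar_brownian_motion_def)
  interpret prob_space M using BR by (simp add: standard_brownian_motion_def)
  have t: "0 \<le> ?t 0" "\<forall>i<k. ?t i \<le> ?t (Suc i)" for k
    using h by (auto intro!: mult_right_mono)
  have ia: "indep_vars (\<lambda>_. borel) a {..<k}" for k
    using standard_brownian_motion_increments[OF BR t] unfolding a_def [abs_def] .
  have ib: "indep_vars (\<lambda>_. borel) b {..<k}" for k
    using standard_brownian_motion_increments[OF BI t] unfolding b_def [abs_def] .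
  have st: "0 \<le> ?t k" "?t k < ?t (Suc k)" "?t (Suc k) - ?t k = h" for k
    using h by (auto simp: algebra_simps)
  have da: "distributed M lborel (a k) (normal_density 0 (sqrt h))" for k
    using BR st[of k] unfolding standard_brownian_motion_def a_def [abs_def] by metis
  have db: "distributed M lborel (b k) (normal_density 0 (sqrt h))" for k
    using BI st[of k] unfolding standard_brownian_motion_def b_def [abs_def] by metis
  have iab: "indep_var (PiM {..<k} (\<lambda>_. borel)) (\<lambda>\<omega>. \<lambda>i\<in>{..<k}. a i \<omega>) (PiM {..<k} (\<lambda>_. borel)) (\<lambda>\<omega>. \<lambda>i\<in>{..<k}. b i \<omega>)" for k
  proof -
    \<comment> \<open>The vector of grid increments as a measurable functional of a path; it reads
      only nonnegative times, so restricting paths to \<open>{0..}\<close> does not change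
      it.\<close>
    let ?f = "\<lambda>w. \<lambda>i\<in>{..<k}. (w (?t (Suc i)) - w (?t i) :: real)"
    have f: "?f \<in> PiM {0..} (\<lambda>_. borel) \<rightarrow>\<^sub>M PiM {..<k} (\<lambda>_. borel)"
      using h by (intro measurable_restrict borel_measurable_diff measurable_component_singleton) auto
    have "?f (\<lambda>t\<in>{0..}. g t) = (\<lambda>i\<in>{..<k}. g (?t (Suc i)) - g (?t i))" for g
      using h by (auto simp: fun_eq_iff)
    with indep_var_compose[OF ind f f] show ?thesis
      by (simp only: comp_def a_def b_def)
  qed
  have ic: "indep_var borel (a k) borel (b k)" for k
  proof -
    have f: "(\<lambda>w. w k) \<in> borel_measurable (PiM {..<Suc k} (\<lambda>_. borel :: real measure))"
      by (rule measurable_component_singleton) simp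
    from indep_var_compose[OF iab f f] show ?thesis by (simp add: comp_def)
  qed
  have xi: "W (?t (Suc k)) \<omega> - W (?t k) \<omega> = Complex (a k \<omega>) (b k \<omega>)" for k \<omega>
    by (simp add: a_def b_def complex_eq_iff)
  have ip: "indep_vars (\<lambda>_. borel) (\<lambda>k \<omega>. Complex (a k \<omega>) (b k \<omega>)) {..<k}" for k
  proof -
    \<comment> \<open>One extra index keeps the index set nonempty, as
      \<open>indep_vars_Pair\<close> requires; it is dropped again below.\<close>
    have "indep_vars (\<lambda>_. borel \<Otimes>\<^sub>M borel) (\<lambda>i \<omega>. (a i \<omega>, b i \<omega>)) {..<Suc k}"
      by (intro indep_vars_Pair ia ib iab) auto
    from indep_vars_compose2[OF this, of "\<lambda>_ (x, y). Complex x y" "\<lambda>_. borel", OF borel_measurable_Complex]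
    have "indep_vars (\<lambda>_. borel) (\<lambda>k \<omega>. Complex (a k \<omega>) (b k \<omega>)) {..<Suc k}" by simp
    then show ?thesis by (rule indep_vars_subset) auto
  qed
  show ?thesis
    unfolding xi
  proof
    fix k
    show "indep_vars (\<lambda>_. borel) (\<lambda>k \<omega>. Complex (a k \<omega>) (b k \<omega>)) {..<k}" by (rule ip)
    show "distr M borel (\<lambda>\<omega>. \<i> * Complex (a k \<omega>) (b k \<omega>)) = distr M borel (\<lambda>\<omega>. Complex (a k \<omega>) (b k \<omega>))"
      by (rule gaussian_pair_rotation[OF h da db ic])
    have "(cmod (Complex x y))\<^sup>2 = x\<^sup>2 + y\<^sup>2" "cmod (Complex x y) ^ 4 = (x\<^sup>2 + y\<^sup>2)\<^sup>2" for x y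
      using power_mult[of "cmod (Complex x y)" 2 2] by (simp_all add: cmod_def)
    then show "has_bochner_integral M (\<lambda>\<omega>. (cmod (Complex (a k \<omega>) (b k \<omega>)))\<^sup>2) (2 * h)"
      "has_bochner_integral M (\<lambda>\<omega>. cmod (Complex (a k \<omega>) (b k \<omega>)) ^ 4) (8 * h\<^sup>2)"
      using gaussian_pair_moments[OF h da db ic] by simp_all
  qed fact
qed

section \<open>First passage along dyadic times\<close>

text \<open>The infimum runs over dyadic times only. This makes it measurable in the path and the decreasing
  limit of the passage times on the grids of mesh \<open>2\<^bsup>-m\<^esup>\<close>, each of which is the exit step of a random
  walk; for continuous paths it still reaches the level exactly.\<close>

definition passage :: "(real \<Rightarrow> real) \<Rightarrow> real \<Rightarrow> ennreal" where
  "passage p r = (INF k. INF m. if r \<le> p (real k * (1 / 2) ^ m) then ennreal (real k * (1 / 2) ^ m) else top)"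

lemma passage_le: "r \<le> p (real k * (1 / 2) ^ m) \<Longrightarrow> passage p r \<le> ennreal (real k * (1 / 2) ^ m)"
  unfolding passage_def by (rule INF_lower2[of k], simp, rule INF_lower2[of m]) auto

lemma passage_mono: "r \<le> r' \<Longrightarrow> passage p r \<le> passage p r'"
  unfolding passage_def by (intro INF_mono') auto

text \<open>The grids are nested, so once the level is reached on grid \<open>m0\<close> the passage
  times on finer grids decrease to some \<open>T\<close>. At these times \<open>p\<close> is at
  least \<open>r\<close>, one mesh earlier it is below \<open>r\<close>, and both sequences of times
  tend to \<open>T\<close>; continuity forces \<open>p T = r\<close>.\<close>

lemma passage_dyadic:
  fixes p :: "real \<Rightarrow> real" and r :: real
  defines "t \<equiv> \<lambda>m. real (LEAST k. r \<le> p (real k * (1 / 2) ^ m)) * (1 / 2) ^ m"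
  assumes cont: "continuous_on {0..} p" and p0: "p 0 < r" and ex: "\<exists>k. r \<le> p (real k * (1 / 2) ^ m0)"
  shows "\<exists>T\<ge>0. t \<longlonglongrightarrow> T \<and> p T = r \<and> passage p r = ennreal T"
    and "m0 \<le> m \<Longrightarrow> t m \<le> t m0"
proof -
  define N where "N m = (LEAST k. r \<le> p (real k * (1 / 2) ^ m))" for m
  define s where "s m = t (m + m0)" for m
  have t: "t m = real (N m) * (1 / 2) ^ m" for m by (simp add: t_def N_def)
  have refine: "real k * (1 / 2) ^ m = real (k * 2 ^ i) * (1 / 2) ^ (m + i)" for k m i
    by (simp add: power_add power_divide)
  have exm: "\<exists>k. r \<le> p (real k * (1 / 2) ^ (m + m0))" for m
    using ex refine[of _ m0 m] by (metis add.commute)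
  have N: "r \<le> p (t (m + m0))" for m
    unfolding t_def using exm by (rule LeastI_ex)
  have N_le: "N m \<le> k" if "r \<le> p (real k * (1 / 2) ^ m)" for k m
    unfolding N_def using that by (rule Least_le)
  have dec: "s (Suc m) \<le> s m" for m
  proof -
    have "r \<le> p (real (N (m + m0) * 2 ^ 1) * (1 / 2) ^ (m + m0 + 1))"
      using N[of m] unfolding t by (subst refine[symmetric])
    from N_le[OF this] have "real (N (m + m0 + 1)) \<le> real (N (m + m0) * 2 ^ 1)" by (simp only: of_nat_le_iff)
    then have "s (Suc m) \<le> real (N (m + m0) * 2 ^ 1) * (1 / 2) ^ (m + m0 + 1)"
      unfolding s_def t by (intro mult_mono) (auto simp del: power_Suc)
    also have "\<dots> = s m" unfolding s_def t by (rule refine[symmetric])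
    finally show ?thesis .
  qed
  then have decseq: "decseq s" by (rule decseq_SucI)
  show "t m \<le> t m0" if "m0 \<le> m" for m
    using decseqD[OF decseq, of 0 "m - m0"] that by (simp add: s_def)
  have s0: "0 \<le> s m" for m by (simp add: s_def t)
  from decseq_convergent[OF decseq, of 0] s0 obtain T where T: "s \<longlonglongrightarrow> T" "\<And>i. T \<le> s i" by blast
  have T0: "0 \<le> T" by (rule LIMSEQ_le_const[OF T(1)]) (use s0 in auto)
  have lim: "(\<lambda>m. p (u m)) \<longlonglongrightarrow> p T" if "u \<longlonglongrightarrow> T" "\<And>m. 0 \<le> u m" for u
    using that T0 by (intro continuous_on_tendsto_compose[OF cont]) auto
  have "r \<le> p T"
    using N by (intro LIMSEQ_le_const[OF lim[OF T(1) s0]]) (auto simp: s_def)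
  moreover have "p T \<le> r"
  proof -
    \<comment> \<open>The grid point just before the passage. It exists because
      \<open>p 0 < r\<close> excludes a passage at index 0.\<close>
    define u where "u m = s m - (1 / 2) ^ (m + m0)" for m
    have N1: "N (m + m0) \<noteq> 0" for m
      using N[of m] p0 unfolding t by (intro notI) simp
    have u: "u m = real (N (m + m0) - 1) * (1 / 2) ^ (m + m0)" for m
      using N1[of m] by (simp add: u_def s_def t of_nat_diff algebra_simps)
    have ur: "p (u m) < r" for m
      using not_less_Least[of "N (m + m0) - 1" "\<lambda>k. r \<le> p (real k * (1 / 2) ^ (m + m0))"] N1[of m]
      unfolding u N_def[symmetric] by simp
    have u0: "0 \<le> u m" for m by (simp add: u)
    have "u \<longlonglongrightarrow> T - 0"
      unfolding u_def by (intro tendsto_diff T LIMSEQ_ignore_initial_segment LIMSEQ_realpow_zero) auto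
    then have "u \<longlonglongrightarrow> T" by simp
    then have "(\<lambda>m. p (u m)) \<longlonglongrightarrow> p T" by (rule lim) (rule u0)
    then show ?thesis by (rule LIMSEQ_le_const2) (auto intro: less_imp_le ur)
  qed
  moreover have "passage p r = ennreal T"
  proof (rule antisym)
    have "passage p r \<le> ennreal (s m)" for m
      using passage_le[of r p "N (m + m0)" "m + m0"] N[of m] unfolding s_def t by simp
    moreover have "(\<lambda>m. ennreal (s m)) \<longlonglongrightarrow> ennreal T"
      by (intro tendsto_ennrealI T)
    ultimately show "passage p r \<le> ennreal T" by (intro LIMSEQ_le_const) auto
    have "T \<le> real k * (1 / 2) ^ m" if k: "r \<le> p (real k * (1 / 2) ^ m)" for k m
    proof -
      have "r \<le> p (real (k * 2 ^ m0) * (1 / 2) ^ (m + m0))"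
        using k by (subst refine[symmetric])
      from N_le[OF this] have "real (N (m + m0)) \<le> real (k * 2 ^ m0)" by (simp only: of_nat_le_iff)
      then have "s m \<le> real (k * 2 ^ m0) * (1 / 2) ^ (m + m0)"
        unfolding s_def t by (intro mult_mono) auto
      with T(2)[of m] show ?thesis by (subst refine[of _ _ m0]) linarith
    qed
    then show "ennreal T \<le> passage p r"
      unfolding passage_def by (intro INF_greatest) (auto intro!: ennreal_leI)
  qed
  moreover have "t \<longlonglongrightarrow> T"
    by (rule LIMSEQ_offset[of _ m0]) (use T(1) in \<open>simp add: s_def [abs_def]\<close>)
  ultimately show "\<exists>T\<ge>0. t \<longlonglongrightarrow> T \<and> p T = r \<and> passage p r = ennreal T"
    using T0 by auto
qed

text \<open>The strict inequality at \<open>t\<close> persists at nearby dyadic times, here obtained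
  by rounding \<open>t\<close> up on each grid.\<close>

lemma passage_le_time:
  fixes p :: "real \<Rightarrow> real"
  assumes cont: "continuous_on {0..} p" and t: "0 \<le> t" "r < p t"
  shows "passage p r \<le> ennreal t"
proof -
  define k where "k m = nat \<lceil>t * 2 ^ m\<rceil>" for m :: nat
  define d where "d m = real (k m) * (1 / 2) ^ m" for m
  have k: "t * 2 ^ m \<le> real (k m)" "real (k m) \<le> t * 2 ^ m + 1" for m
    using t by (auto simp: k_def of_nat_nat intro: le_of_int_ceiling) 
  have d: "t \<le> d m" "d m \<le> t + (1 / 2) ^ m" for m
    using k[of m] by (auto simp: d_def power_divide field_simps)
  have "(\<lambda>m. t + (1 / 2 :: real) ^ m) \<longlonglongrightarrow> t + 0"
    by (intro tendsto_intros LIMSEQ_realpow_zero) auto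
  then have dt: "d \<longlonglongrightarrow> t"
    by (intro tendsto_sandwich[of "\<lambda>_. t" d sequentially "\<lambda>m. t + (1 / 2) ^ m" t]) (use d in auto)
  have "(\<lambda>m. p (d m)) \<longlonglongrightarrow> p t"
    using t order_trans[OF t(1) d(1)] by (intro continuous_on_tendsto_compose[OF cont dt]) auto
  then have "eventually (\<lambda>m. r < p (d m)) sequentially" using t(2) by (rule order_tendstoD)
  then have "eventually (\<lambda>m. passage p r \<le> ennreal (d m)) sequentially"
    by eventually_elim (auto simp: d_def intro: passage_le)
  moreover have "(\<lambda>m. ennreal (d m)) \<longlonglongrightarrow> ennreal t" by (intro tendsto_ennrealI dt)
  ultimately show ?thesis by (intro tendsto_lowerbound) auto
qed

text \<open>If the passage times stay bounded, they increase to a limit \<open>L\<close>, and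
  continuity gives \<open>p L = c\<close>, so \<open>L\<close> competes in the infimum. The other
  inequality is \<open>passage_le_time\<close>, applicable because every \<open>r j\<close> is below
  \<open>c\<close>.\<close>

lemma SUP_passage:
  fixes p :: "real \<Rightarrow> real" and r :: "nat \<Rightarrow> real"
  assumes cont: "continuous_on {0..} p" and r: "incseq r" "r \<longlonglongrightarrow> c" "\<And>j. r j < c"
    and hit: "\<And>j. \<exists>T\<ge>0. p T = r j \<and> passage p (r j) = ennreal T"
  shows "(SUP j. passage p (r j)) = (INF t\<in>{t. 0 \<le> t \<and> c \<le> p t}. ennreal t)"
proof (rule antisym)
  show "(SUP j. passage p (r j)) \<le> (INF t\<in>{t. 0 \<le> t \<and> c \<le> p t}. ennreal t)"
    using r(3) by (intro SUP_least INF_greatest passage_le_time[OF cont]) (auto intro: less_le_trans)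
  obtain T where T: "\<And>j. 0 \<le> T j" "\<And>j. p (T j) = r j" "\<And>j. passage p (r j) = ennreal (T j)"
    using hit by metis
  show "(INF t\<in>{t. 0 \<le> t \<and> c \<le> p t}. ennreal t) \<le> (SUP j. passage p (r j))"
  proof (cases "(SUP j. passage p (r j)) = top")
    case False
    then obtain B where B: "(SUP j. passage p (r j)) = ennreal B" "0 \<le> B"
      by (cases "SUP j. passage p (r j)") auto
    have inc: "incseq T"
    proof (rule incseq_SucI)
      show "T j \<le> T (Suc j)" for j
        using passage_mono[OF incseq_SucD[OF r(1)], of p j] T(1) by (simp add: T(3))
    qed
    have TB: "T j \<le> B" for j
      using SUP_upper[of j UNIV "\<lambda>j. passage p (r j)"] B by (simp add: T(3))
    from incseq_convergent[OF inc, of B] TB obtain L where L: "T \<longlonglongrightarrow> L" "\<And>j. T j \<le> L" by blast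
    have L0: "0 \<le> L" using T(1)[of 0] L(2)[of 0] by linarith
    have "(\<lambda>j. p (T j)) \<longlonglongrightarrow> p L"
      using T(1) L0 by (intro continuous_on_tendsto_compose[OF cont L(1)]) auto
    then have "p L = c" using r(2) unfolding T(2) by (rule LIMSEQ_unique)
    then have "(INF t\<in>{t. 0 \<le> t \<and> c \<le> p t}. ennreal t) \<le> ennreal L"
      using L0 by (intro INF_lower) auto
    also have "L \<le> B" by (rule LIMSEQ_le_const2[OF L(1)]) (use TB in auto)
    finally show ?thesis using B by (simp add: ennreal_leI)
  next
    case True
    then show ?thesis by (simp only: top_greatest)
  qed
qed

text \<open>On the circle of radius \<open>r\<close> every cross term of the squared partial sums is
  a multiple of a positive power of \<open>Y\<close>, whose expectation vanishes. Absolute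
  convergence at radius \<open>r\<close> bounds the partial sums uniformly and justifies the
  limit.\<close>

lemma (in prob_space) parseval_vanishing_moments:
  fixes Y :: "'a \<Rightarrow> complex" and b :: "nat \<Rightarrow> real" and F :: "complex \<Rightarrow> complex"
  assumes [measurable]: "Y \<in> borel_measurable M" "F \<in> borel_measurable borel"
    and r: "AE \<omega> in M. cmod (Y \<omega>) = r" "0 < r" "r < 1"
    and mom: "\<And>k. 1 \<le> k \<Longrightarrow> (\<integral>\<omega>. Y \<omega> ^ k \<partial>M) = 0"
    and F: "\<And>z. cmod z < 1 \<Longrightarrow> (\<lambda>k. of_real (b k) * z ^ k) sums F z"
  shows "(\<lambda>k. (b k)\<^sup>2 * r ^ (2 * k)) sums (\<integral>\<omega>. (cmod (F (Y \<omega>)))\<^sup>2 \<partial>M)"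
proof -
  define S where "S N z = (\<Sum>k<N. complex_of_real (b k) * z ^ k)" for N z
  have [measurable]: "S N \<in> borel_measurable borel" for N
    unfolding S_def [abs_def] by measurable
  have "summable (\<lambda>k. norm (complex_of_real (b k) * complex_of_real r ^ k))"
    \<comment> \<open>The point \<open>(r + 1) / 2\<close> lies strictly between \<open>r\<close>
      and 1, so convergence there gives absolute convergence at \<open>r\<close>.\<close>
    using F[of "complex_of_real ((r + 1) / 2)"] r
    by (intro powser_insidea[where x = "complex_of_real ((r + 1) / 2)"]) (auto simp: sums_iff norm_of_real simp del: of_real_divide of_real_add)
  then have sb: "summable (\<lambda>k. \<bar>b k\<bar> * r ^ k)"
    using r by (simp add: norm_mult norm_power)
  define B where "B = (\<Sum>k. \<bar>b k\<bar> * r ^ k)"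
  have SB: "cmod (S N z) \<le> B" if "cmod z = r" for N z
  proof -
    have "cmod (S N z) \<le> (\<Sum>k<N. \<bar>b k\<bar> * r ^ k)"
      unfolding S_def using that by (intro sum_norm_le) (simp add: norm_mult norm_power)
    also have "\<dots> \<le> B" unfolding B_def using r by (intro sum_le_suminf sb) auto
    finally show ?thesis .
  qed
  have intY: "integrable M (\<lambda>\<omega>. of_real c * Y \<omega> ^ k)" for c k
    by (rule integrable_const_bound[of _ "\<bar>c\<bar> * r ^ k"])
       (use r(1) in \<open>eventually_elim, simp add: norm_mult norm_power\<close>, measurable)
  have fin: "integrable M (\<lambda>\<omega>. (cmod (S N (Y \<omega>)))\<^sup>2) \<and> (\<integral>\<omega>. (cmod (S N (Y \<omega>)))\<^sup>2 \<partial>M) = (\<Sum>k<N. (b k)\<^sup>2 * r ^ (2 * k))" for N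
  proof (induction N)
    case 0 then show ?case by (simp add: S_def)
  next
    case (Suc N)
    have eq: "AE \<omega> in M. (cmod (S (Suc N) (Y \<omega>)))\<^sup>2 =
       (cmod (S N (Y \<omega>)))\<^sup>2 + (b N)\<^sup>2 * r ^ (2 * N) + 2 * Re (\<Sum>k<N. of_real (b k * b N * r ^ (2 * k)) * Y \<omega> ^ (N - k))"
      using r(1)
    proof eventually_elim
      case (elim \<omega>)
      let ?y = "Y \<omega>"
      \<comment> \<open>Since \<open>k < N\<close>, pairing \<open>Y ^ k\<close> with its conjugate
        leaves the power \<open>N - k \<ge> 1\<close>, to which \<open>mom\<close> applies.\<close>
      have cn: "cnj (?y ^ k) * ?y ^ N = of_real (r ^ (2 * k)) * ?y ^ (N - k)" if "k < N" for k
      proof -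
        have "cnj (?y ^ k) * ?y ^ N = (?y ^ k * cnj (?y ^ k)) * ?y ^ (N - k)"
          using that by (simp add: power_add[symmetric] mult_ac)
        also have "?y ^ k * cnj (?y ^ k) = of_real ((cmod (?y ^ k))\<^sup>2)"
          by (rule complex_norm_square[symmetric])
        finally show ?thesis using elim by (simp add: norm_power power_mult mult.commute[of 2 k])
      qed
      have "(cmod (S (Suc N) ?y))\<^sup>2 = (cmod (S N ?y + of_real (b N) * ?y ^ N))\<^sup>2"
        by (simp add: S_def)
      also have "\<dots> = (cmod (S N ?y))\<^sup>2 + (cmod (of_real (b N) * ?y ^ N))\<^sup>2 + 2 * Re (cnj (S N ?y) * (of_real (b N) * ?y ^ N))"
        unfolding cmod_power2 by (simp add: power2_eq_square algebra_simps)
      also have "(cmod (of_real (b N) * ?y ^ N))\<^sup>2 = (b N)\<^sup>2 * r ^ (2 * N)"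
        using elim by (simp add: norm_mult norm_power power_mult_distrib power_mult[symmetric] mult.commute[of 2 N])
      also have "cnj (S N ?y) * (of_real (b N) * ?y ^ N) = (\<Sum>k<N. of_real (b k * b N) * (cnj (?y ^ k) * ?y ^ N))"
        unfolding S_def cnj_sum sum_distrib_right by (intro sum.cong refl) (simp add: mult_ac)
      also have "\<dots> = (\<Sum>k<N. of_real (b k * b N * r ^ (2 * k)) * ?y ^ (N - k))"
      proof (intro sum.cong refl)
        fix k assume "k \<in> {..<N}"
        then have k: "k < N" by simp
        show "complex_of_real (b k * b N) * (cnj (?y ^ k) * ?y ^ N) = of_real (b k * b N * r ^ (2 * k)) * ?y ^ (N - k)"
          unfolding cn[OF k] by (simp only: of_real_mult mult.assoc)
      qed
      finally show ?case .
    qed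
    let ?R = "\<lambda>\<omega>. \<Sum>k<N. of_real (b k * b N * r ^ (2 * k)) * Y \<omega> ^ (N - k)"
    have iR: "integrable M ?R" by (intro Bochner_Integration.integrable_sum intY)
    have ER: "(\<integral>\<omega>. ?R \<omega> \<partial>M) = 0"
      by (subst Bochner_Integration.integral_sum[OF intY]) (simp add: mom)
    have iRe: "integrable M (\<lambda>\<omega>. Re (?R \<omega>))" using iR by (rule integrable_Re)
    have "(\<integral>\<omega>. Re (?R \<omega>) \<partial>M) = Re (\<integral>\<omega>. ?R \<omega> \<partial>M)" using iR by (rule integral_Re)
    then have ERe: "(\<integral>\<omega>. Re (?R \<omega>) \<partial>M) = 0" using ER by simp
    have i: "integrable M (\<lambda>\<omega>. (cmod (S N (Y \<omega>)))\<^sup>2 + (b N)\<^sup>2 * r ^ (2 * N) + 2 * Re (?R \<omega>))"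
      using Suc iRe by (intro Bochner_Integration.integrable_add) auto
    have "integrable M (\<lambda>\<omega>. (cmod (S (Suc N) (Y \<omega>)))\<^sup>2)"
      by (subst integrable_cong_AE[OF _ _ eq]) (use i in \<open>auto intro: borel_measurable_integrable\<close>)
    moreover have "(\<integral>\<omega>. (cmod (S (Suc N) (Y \<omega>)))\<^sup>2 \<partial>M) = (\<integral>\<omega>. (cmod (S N (Y \<omega>)))\<^sup>2 + (b N)\<^sup>2 * r ^ (2 * N) + 2 * Re (?R \<omega>) \<partial>M)"
      by (rule integral_cong_AE[OF _ _ eq]) (use i in \<open>auto intro: borel_measurable_integrable\<close>)
    moreover have "\<dots> = (\<integral>\<omega>. (cmod (S N (Y \<omega>)))\<^sup>2 \<partial>M) + (b N)\<^sup>2 * r ^ (2 * N) + 2 * (\<integral>\<omega>. Re (?R \<omega>) \<partial>M)"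
      using Suc iRe by (subst Bochner_Integration.integral_add, simp, simp)+ (simp add: prob_space)
    ultimately show ?case using Suc ERe by simp
  qed
  have "(\<lambda>N. \<integral>\<omega>. (cmod (S N (Y \<omega>)))\<^sup>2 \<partial>M) \<longlonglongrightarrow> (\<integral>\<omega>. (cmod (F (Y \<omega>)))\<^sup>2 \<partial>M)"
  proof (rule integral_dominated_convergence[where w = "\<lambda>_. B\<^sup>2"])
    show "AE \<omega> in M. (\<lambda>N. (cmod (S N (Y \<omega>)))\<^sup>2) \<longlonglongrightarrow> (cmod (F (Y \<omega>)))\<^sup>2"
      using r(1)
    proof eventually_elim
      case (elim \<omega>)
      have "(\<lambda>N. S N (Y \<omega>)) \<longlonglongrightarrow> F (Y \<omega>)"
        using F[of "Y \<omega>"] elim r by (simp add: sums_def S_def)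
      then show ?case by (intro tendsto_intros)
    qed
    show "AE \<omega> in M. norm ((cmod (S N (Y \<omega>)))\<^sup>2) \<le> B\<^sup>2" for N
      using r(1) by eventually_elim (auto intro!: power_mono SB)
  qed auto
  then show ?thesis using fin by (simp add: sums_def)
qed

section \<open>Path properties of planar Brownian motion\<close>

lemma planar_brownian_motion_continuous:
  assumes "planar_brownian_motion M W"
  shows "AE \<omega> in M. continuous_on {0..} (\<lambda>t. W t \<omega>)"
proof -
  from assms have "AE \<omega> in M. continuous_on {0..} (\<lambda>t. Re (W t \<omega>))" "AE \<omega> in M. continuous_on {0..} (\<lambda>t. Im (W t \<omega>))"
    by (auto simp: planar_brownian_motion_def standard_brownian_motion_def)
  then show ?thesis
  proof eventually_elim
    case (elim \<omega>)
    then have "continuous_on {0..} (\<lambda>t. of_real (Re (W t \<omega>)) + \<i> * of_real (Im (W t \<omega>)))"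
      by (intro continuous_on_add continuous_on_mult continuous_on_const continuous_on_of_real)
    then show ?case by (simp add: complex_eq[symmetric])
  qed
qed

lemma planar_brownian_motion_start:
  assumes "planar_brownian_motion M W"
  shows "AE \<omega> in M. W 0 \<omega> = 0"
proof -
  from assms have "AE \<omega> in M. Re (W 0 \<omega>) = 0" "AE \<omega> in M. Im (W 0 \<omega>) = 0"
    by (auto simp: planar_brownian_motion_def standard_brownian_motion_def)
  then show ?thesis by eventually_elim (simp add: complex_eq_iff)
qed

lemma planar_brownian_motion_measurable:
  assumes "planar_brownian_motion M W" "0 \<le> t"
  shows "W t \<in> borel_measurable M"
  using assms by (subst borel_measurable_complex_iff) (auto simp: planar_brownian_motion_def standard_brownian_motion_def)

section \<open>Expected passage times of the levels of the disc map\<close>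

locale level_passage =
  fixes M :: "'a measure" and W :: "real \<Rightarrow> 'a \<Rightarrow> complex" and n :: nat and r :: real
  assumes W: "planar_brownian_motion M W" and n: "1 \<le> n" and r: "0 < r" "r < 1"
begin

sublocale prob_space M
  using W by (simp add: planar_brownian_motion_def standard_brownian_motion_def)

text \<open>The start \<open>W 0 = 0\<close> holds only almost surely, whereas a walk starts exactly
  at 0; subtracting \<open>W 0\<close> makes the two agree on every path.\<close>

definition X :: "real \<Rightarrow> 'a \<Rightarrow> complex" where "X t \<omega> = W t \<omega> - W 0 \<omega>"
definition U :: "complex set" where "U = {x. cmod (disc_power n x) < r}"
definition step :: "nat \<Rightarrow> 'a \<Rightarrow> nat" where
  "step m \<omega> = (LEAST k. r \<le> cmod (disc_power n (X (real k * (1 / 2) ^ m) \<omega>)))"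
definition time :: "nat \<Rightarrow> 'a \<Rightarrow> real" where "time m \<omega> = real (step m \<omega>) * (1 / 2) ^ m"
definition position :: "nat \<Rightarrow> 'a \<Rightarrow> complex" where "position m \<omega> = X (time m \<omega>) \<omega>"

lemma sets_U: "U \<in> sets borel"
  unfolding U_def by (intro borel_open open_Collect_less continuous_cmod_disc_power continuous_intros)

text \<open>All meshes are needed at once on one probability space. This is the dictionary between
  the notions of the walk locale at mesh \<open>(1 / 2) ^ m\<close> and those of
  \<open>X\<close>.\<close>

lemma dyadic_walk:
  fixes m defines "xi \<equiv> \<lambda>k \<omega>. W (real (Suc k) * (1 / 2) ^ m) \<omega> - W (real k * (1 / 2) ^ m) \<omega>"
  shows "planar_walk M xi ((1 / 2) ^ m)"
    and "planar_walk.walk xi k \<omega> = X (real k * (1 / 2) ^ m) \<omega>"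
    and "planar_walk.exit_step xi U \<omega> = step m \<omega>"
    and "planar_walk.walk xi (planar_walk.exit_step xi U \<omega>) \<omega> = position m \<omega>"
proof -
  show pw: "planar_walk M xi ((1 / 2) ^ m)"
    unfolding xi_def by (rule planar_brownian_motion_walk[OF W]) simp
  show walk: "planar_walk.walk xi k \<omega> = X (real k * (1 / 2) ^ m) \<omega>" for k \<omega>
    unfolding planar_walk.walk_def[OF pw] X_def
    using sum_lessThan_telescope[of "\<lambda>i. W (real i * (1 / 2) ^ m) \<omega>" k] by (simp add: xi_def)
  show st: "planar_walk.exit_step xi U \<omega> = step m \<omega>"
    unfolding planar_walk.exit_step_def[OF pw] step_def walk U_def by (simp add: not_less)
  show "planar_walk.walk xi (planar_walk.exit_step xi U \<omega>) \<omega> = position m \<omega>"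
    unfolding st walk position_def time_def ..
qed

lemma measurable_position: "position m \<in> borel_measurable M"
  using planar_walk.measurable_exit_position[OF dyadic_walk(1) sets_U, of m] unfolding dyadic_walk(4) .

lemma measurable_time: "time m \<in> borel_measurable M"
proof -
  have "step m \<in> M \<rightarrow>\<^sub>M count_space UNIV"
    using planar_walk.measurable_exit_step[OF dyadic_walk(1) sets_U, of m] unfolding dyadic_walk(3) [abs_def] .
  then show ?thesis unfolding time_def [abs_def] by measurable
qed

text \<open>A bound for the level set together with a grid that is fine enough for \<open>sum_alive_le\<close>.\<close>

definition adapted :: "real \<Rightarrow> nat \<Rightarrow> bool" where
  "adapted R m0 \<longleftrightarrow> 0 \<le> R \<and> (\<forall>x. cmod (disc_power n x) \<le> r \<longrightarrow> cmod x \<le> R) \<and>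
     (\<forall>m\<ge>m0. 8 * ((R + 1)\<^sup>2 + 1) * (1 / 2) ^ m \<le> 1)"

lemma adaptedD:
  assumes "adapted R m0"
  shows "0 \<le> R" "cmod (disc_power n x) \<le> r \<Longrightarrow> cmod x \<le> R" "x \<in> U \<Longrightarrow> cmod x \<le> R"
    "m0 \<le> m \<Longrightarrow> 8 * ((R + 1)\<^sup>2 + 1) * (1 / 2) ^ m \<le> 1"
  using assms by (auto simp: adapted_def U_def)

lemma adapted_exists:
  obtains R m0 where "adapted R m0"
proof -
  obtain R where R: "0 \<le> R" "\<And>x. cmod (disc_power n x) \<le> r \<Longrightarrow> cmod x \<le> R"
    using bounded_disc_power_le[OF n r(2)] unfolding bounded_pos by (auto intro: less_imp_le)
  have "(\<lambda>m. 8 * ((R + 1)\<^sup>2 + 1) * (1 / 2) ^ m) \<longlonglongrightarrow> 8 * ((R + 1)\<^sup>2 + 1) * 0"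
    by (intro tendsto_intros LIMSEQ_realpow_zero) auto
  then have "eventually (\<lambda>m. 8 * ((R + 1)\<^sup>2 + 1) * (1 / 2) ^ m < 1) sequentially"
    by (intro order_tendstoD) auto
  then obtain m0 where "\<And>m. m0 \<le> m \<Longrightarrow> 8 * ((R + 1)\<^sup>2 + 1) * (1 / 2) ^ m < 1"
    by (auto simp: eventually_sequentially)
  with R have "adapted R m0" unfolding adapted_def by (auto simp del: distrib_left_numeral intro: less_imp_le)
  then show thesis by (rule that)
qed

text \<open>Taking \<open>lim\<close> yields a total function that is measurable without any choice
  on the exceptional null set; \<open>AE_hit\<close> shows that the limit exists almost
  surely.\<close>

definition hit_time :: "'a \<Rightarrow> real" where "hit_time \<omega> = lim (\<lambda>m. time m \<omega>)"
definition hit_position :: "'a \<Rightarrow> complex" where "hit_position \<omega> = lim (\<lambda>m. position m \<omega>)"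

lemma measurable_hit: "hit_time \<in> borel_measurable M" "hit_position \<in> borel_measurable M"
  unfolding hit_time_def [abs_def] hit_position_def [abs_def]
  by (intro borel_measurable_lim_metric measurable_time measurable_position)+

abbreviation path :: "'a \<Rightarrow> real \<Rightarrow> real" where "path \<omega> t \<equiv> cmod (disc_power n (X t \<omega>))"

text \<open>This is \<open>passage_dyadic\<close> applied path by path; that the level is reached on
  the grid \<open>m0\<close> holds almost surely by \<open>AE_exit\<close>.\<close>

lemma AE_hit:
  assumes A: "adapted R m0"
  shows "AE \<omega> in M. (\<lambda>m. time m \<omega>) \<longlonglongrightarrow> hit_time \<omega> \<and> (\<lambda>m. position m \<omega>) \<longlonglongrightarrow> hit_position \<omega> \<and>
     0 \<le> hit_time \<omega> \<and> path \<omega> (hit_time \<omega>) = r \<and> passage (path \<omega>) r = ennreal (hit_time \<omega>) \<and>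
     cmod (disc_power n (hit_position \<omega>)) = r \<and> (\<forall>m\<ge>m0. time m \<omega> \<le> time m0 \<omega>)"
proof -
  have "AE \<omega> in M. \<exists>k. X (real k * (1 / 2) ^ m0) \<omega> \<notin> U"
    using planar_walk.AE_exit[OF dyadic_walk(1) sets_U adaptedD(3)[OF A] adaptedD(1)[OF A] adaptedD(4)[OF A order_refl]] unfolding dyadic_walk(2) by (simp add: U_def)
  with planar_brownian_motion_continuous[OF W] show ?thesis
  proof eventually_elim
    case (elim \<omega>)
    have contX: "continuous_on {0..} (\<lambda>t. X t \<omega>)"
      unfolding X_def by (intro continuous_intros elim)
    have cont: "continuous_on {0..} (path \<omega>)"
      using continuous_on_compose2[OF continuous_cmod_disc_power contX] by simp
    have p0: "path \<omega> 0 < r" using n r by (simp add: X_def)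
    have ex: "\<exists>k. r \<le> path \<omega> (real k * (1 / 2) ^ m0)" using elim(2) by (auto simp: U_def not_less)
    from passage_dyadic(1)[OF cont p0 ex] obtain T
      where T: "0 \<le> T" "(\<lambda>m. time m \<omega>) \<longlonglongrightarrow> T" "path \<omega> T = r" "passage (path \<omega>) r = ennreal T"
      unfolding time_def step_def by blast
    have "hit_time \<omega> = T" unfolding hit_time_def using T(2) by (rule limI)
    moreover have V: "(\<lambda>m. position m \<omega>) \<longlonglongrightarrow> X T \<omega>"
      unfolding position_def using T
      by (intro continuous_on_tendsto_compose[OF contX]) (auto simp: time_def)
    then have "hit_position \<omega> = X T \<omega>" unfolding hit_position_def by (rule limI)
    ultimately show ?case
      using T V passage_dyadic(2)[OF cont p0 ex] unfolding time_def step_def by auto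
  qed
qed

lemma integrable_time:
  assumes A: "adapted R m0" "m0 \<le> m"
  shows "integrable M (time m)"
  using planar_walk.expectation_exit_step[OF dyadic_walk(1) sets_U adaptedD(3)[OF A(1)] adaptedD(1)[OF A(1)] adaptedD(4)[OF A], THEN integrable.intros]
  unfolding dyadic_walk(3) time_def [abs_def] by (simp add: U_def)

text \<open>From \<open>m0\<close> on the grid times are at most \<open>time m0\<close>, a multiple
  of an integrable exit step, so dominated convergence applies.\<close>

lemma hit_time_integral:
  assumes A: "adapted R m0"
  shows "integrable M hit_time" "(\<lambda>m. \<integral>\<omega>. time m \<omega> \<partial>M) \<longlonglongrightarrow> (\<integral>\<omega>. hit_time \<omega> \<partial>M)"
proof -
  note [measurable] = measurable_time measurable_hit
  have i: "integrable M (time m0)" by (rule integrable_time[OF A order_refl])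
  have l: "AE \<omega> in M. (\<lambda>m. time (m + m0) \<omega>) \<longlonglongrightarrow> hit_time \<omega>"
    using AE_hit[OF A] by eventually_elim (auto intro: LIMSEQ_ignore_initial_segment)
  have b: "AE \<omega> in M. norm (time (m + m0) \<omega>) \<le> time m0 \<omega>" for m
    using AE_hit[OF A] by eventually_elim (auto simp: time_def)
  show "integrable M hit_time"
    by (rule integrable_dominated_convergence[OF _ _ i l b]) auto
  have "(\<lambda>m. \<integral>\<omega>. time (m + m0) \<omega> \<partial>M) \<longlonglongrightarrow> (\<integral>\<omega>. hit_time \<omega> \<partial>M)"
    by (rule integral_dominated_convergence[OF _ _ i l b]) auto
  then show "(\<lambda>m. \<integral>\<omega>. time m \<omega> \<partial>M) \<longlonglongrightarrow> (\<integral>\<omega>. hit_time \<omega> \<partial>M)" by (rule LIMSEQ_offset)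
qed

text \<open>In \<open>exit_estimate\<close> the error is the mesh times a convergent expectation, so
  it vanishes as the grid is refined. Continuity is asked on the level set, where the hit position
  lies almost surely; this leaves room to cut \<Phi> off further out.\<close>

lemma hit_expectation:
  fixes \<Phi> :: "complex \<Rightarrow> complex"
  assumes \<Phi> [measurable]: "\<Phi> \<in> borel_measurable borel" and bound: "\<And>x. cmod (\<Phi> x) \<le> B"
    and cont: "\<And>x. cmod (disc_power n x) = r \<Longrightarrow> isCont \<Phi> x"
    and avg: "\<And>x y. cmod (disc_power n x) < r \<Longrightarrow> cmod ((\<Phi> (x + y) + \<Phi> (x + \<i> * y) + \<Phi> (x - y) + \<Phi> (x - \<i> * y)) / 4 - \<Phi> x
        - c * of_real ((cmod y)\<^sup>2)) \<le> C * cmod y ^ 4"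
  shows "(\<integral>\<omega>. \<Phi> (hit_position \<omega>) \<partial>M) = \<Phi> 0 + c * of_real (2 * (\<integral>\<omega>. hit_time \<omega> \<partial>M))"
proof -
  note [measurable] = measurable_position measurable_hit
  obtain R m0 where A: "adapted R m0" by (rule adapted_exists)
  note T = hit_time_integral(2)[OF A]
  have est: "cmod ((\<integral>\<omega>. \<Phi> (position m \<omega>) \<partial>M) - \<Phi> 0 - c * of_real (2 * (\<integral>\<omega>. time m \<omega> \<partial>M)))
     \<le> 8 * C * (1 / 2) ^ m * (\<integral>\<omega>. time m \<omega> \<partial>M)" if "m0 \<le> m" for m
  proof -
    have time: "(1 / 2) ^ m * real (step m \<omega>) = time m \<omega>" for \<omega>
      by (simp add: time_def)
    note E = planar_walk.exit_estimate[OF dyadic_walk(1)[of m] sets_U, unfolded dyadic_walk(4), unfolded dyadic_walk(3) time]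
    show ?thesis
    proof (rule E[OF _ _ _ \<Phi> bound])
      show "cmod x \<le> R" if "x \<in> U" for x by (rule adaptedD(3)[OF A that])
      show "cmod ((\<Phi> (x + y) + \<Phi> (x + \<i> * y) + \<Phi> (x - y) + \<Phi> (x - \<i> * y)) / 4 - \<Phi> x
        - c * of_real ((cmod y)\<^sup>2)) \<le> C * cmod y ^ 4" if "x \<in> U" for x y
        using that unfolding U_def mem_Collect_eq by (rule avg)
    qed (rule adaptedD(1)[OF A], rule adaptedD(4)[OF A that])
  qed
  have lim: "(\<lambda>m. \<integral>\<omega>. \<Phi> (position m \<omega>) \<partial>M) \<longlonglongrightarrow> (\<integral>\<omega>. \<Phi> (hit_position \<omega>) \<partial>M)"
  proof (rule integral_dominated_convergence[where w = "\<lambda>_. B"])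
    show "AE \<omega> in M. (\<lambda>m. \<Phi> (position m \<omega>)) \<longlonglongrightarrow> \<Phi> (hit_position \<omega>)"
      using AE_hit[OF A]
    proof eventually_elim
      case (elim \<omega>)
      then show ?case by (intro isCont_tendsto_compose[OF cont]) simp_all
    qed
  qed (use bound in auto)
  have "(\<lambda>m. cmod ((\<integral>\<omega>. \<Phi> (position m \<omega>) \<partial>M) - \<Phi> 0 - c * of_real (2 * (\<integral>\<omega>. time m \<omega> \<partial>M)))) \<longlonglongrightarrow>
     cmod ((\<integral>\<omega>. \<Phi> (hit_position \<omega>) \<partial>M) - \<Phi> 0 - c * of_real (2 * (\<integral>\<omega>. hit_time \<omega> \<partial>M)))"
    by (intro tendsto_intros lim T)
  moreover have "(\<lambda>m. 8 * C * (1 / 2) ^ m * (\<integral>\<omega>. time m \<omega> \<partial>M)) \<longlonglongrightarrow> 8 * C * 0 * (\<integral>\<omega>. hit_time \<omega> \<partial>M)"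
    by (intro tendsto_intros LIMSEQ_realpow_zero T) auto
  ultimately have "cmod ((\<integral>\<omega>. \<Phi> (hit_position \<omega>) \<partial>M) - \<Phi> 0 - c * of_real (2 * (\<integral>\<omega>. hit_time \<omega> \<partial>M))) \<le> 8 * C * 0 * (\<integral>\<omega>. hit_time \<omega> \<partial>M)"
    by (rule LIMSEQ_le) (use est in auto)
  then show ?thesis by (simp add: algebra_simps)
qed

text \<open>The powers are holomorphic on the slit plane, where they are bounded by 1, and are
  continued by 0. Test functions of this kind have \<open>c = 0\<close>, and the origin contributes
  0 because \<open>1 \<le> k\<close>.\<close>

lemma hit_moments:
  assumes "1 \<le> k"
  shows "(\<integral>\<omega>. disc_power n (hit_position \<omega>) ^ k \<partial>M) = 0"
proof -
  define \<Phi> where "\<Phi> x = (if x \<in> slit_plane n then disc_power n x ^ k else 0)" for x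
  have op: "open (slit_plane n)" by (rule open_slit_plane[OF n])
  have hol: "(\<lambda>x. disc_power n x ^ k) holomorphic_on slit_plane n"
    by (intro holomorphic_intros holomorphic_disc_power n)
  then have co: "continuous_on (slit_plane n) (\<lambda>x. disc_power n x ^ k)"
    by (rule holomorphic_on_imp_continuous_on)
  have \<Phi>: "\<Phi> \<in> borel_measurable borel"
    unfolding \<Phi>_def [abs_def]
    using borel_measurable_continuous_on_indicator[OF borel_open[OF op] co]
    by (rule measurable_cong[THEN iffD1, rotated]) (auto simp: indicator_def)
  have bound: "cmod (\<Phi> x) \<le> 1" for x
    by (auto simp: \<Phi>_def slit_plane_eq[OF n] norm_power power_le_one)
  have cont: "isCont \<Phi> x" if "cmod (disc_power n x) = r" for x
  proof -
    have x: "x \<in> slit_plane n" using that r by (simp add: slit_plane_eq[OF n])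
    have "continuous_on (slit_plane n) \<Phi>" using co by (rule continuous_on_eq) (simp add: \<Phi>_def)
    then show ?thesis using x op by (simp add: continuous_on_eq_continuous_at)
  qed
  have cl: "compact {x. cmod (disc_power n x) \<le> r}"
    using bounded_disc_power_le[OF n r(2)] closed_Collect_le[OF continuous_cmod_disc_power[of n] continuous_on_const]
    by (simp add: compact_eq_bounded_closed)
  have "{x. cmod (disc_power n x) \<le> r} \<subseteq> slit_plane n" using r by (auto simp: slit_plane_eq[OF n])
  \<comment> \<open>Compactness of the sublevel set gives one radius for all of its points, hence
    one constant in the four-point estimate.\<close>
  then obtain e where e: "0 < e" "(\<Union>x\<in>{x. cmod (disc_power n x) \<le> r}. ball x e) \<subseteq> slit_plane n"
    using compact_subset_open_imp_ball_epsilon_subset[OF cl op] by metis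
  have avg: "cmod ((\<Phi> (x + y) + \<Phi> (x + \<i> * y) + \<Phi> (x - y) + \<Phi> (x - \<i> * y)) / 4 - \<Phi> x - 0 * of_real ((cmod y)\<^sup>2))
      \<le> 512 / e ^ 4 * cmod y ^ 4" if x: "cmod (disc_power n x) < r" for x y
  proof (cases "cmod y \<le> e / 4")
    case True
    have "x \<in> {x. cmod (disc_power n x) \<le> r}" using x by simp
    with e(2) have sub: "ball x e \<subseteq> slit_plane n" by blast
    have "\<Phi> holomorphic_on ball x e"
      using holomorphic_on_subset[OF hol sub] by (rule holomorphic_transform) (use sub in \<open>auto simp: \<Phi>_def\<close>)
    from holomorphic_four_point_average[OF this bound e(1) True]
    have "cmod ((\<Phi> (x + y) + \<Phi> (x + \<i> * y) + \<Phi> (x - y) + \<Phi> (x - \<i> * y)) / 4 - \<Phi> x) \<le> 32 * 1 / e ^ 4 * cmod y ^ 4" .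
    also have "\<dots> \<le> 512 / e ^ 4 * cmod y ^ 4"
      using e by (intro mult_right_mono divide_right_mono) auto
    finally show ?thesis by simp
  next
    case False
    have "cmod (\<Phi> (x + y) + \<Phi> (x + \<i> * y) + \<Phi> (x - y) + \<Phi> (x - \<i> * y)) \<le> 1 + 1 + 1 + 1"
      by (intro norm_triangle_mono bound)
    then have "cmod ((\<Phi> (x + y) + \<Phi> (x + \<i> * y) + \<Phi> (x - y) + \<Phi> (x - \<i> * y)) / 4) + cmod (\<Phi> x) \<le> 1 + 1"
      by (intro add_mono bound) (simp add: norm_divide)
    then have "cmod ((\<Phi> (x + y) + \<Phi> (x + \<i> * y) + \<Phi> (x - y) + \<Phi> (x - \<i> * y)) / 4 - \<Phi> x) \<le> 2"
      using norm_triangle_ineq4[of "(\<Phi> (x + y) + \<Phi> (x + \<i> * y) + \<Phi> (x - y) + \<Phi> (x - \<i> * y)) / 4" "\<Phi> x"] by linarith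
    \<comment> \<open>Here \<open>512 = 2 * 4 ^ 4\<close>: beyond \<open>e / 4\<close> the trivial
      error bound 2 is absorbed by the fourth power.\<close>
    also have "2 \<le> 512 / e ^ 4 * cmod y ^ 4"
    proof -
      have "(e / 4) ^ 4 \<le> cmod y ^ 4" using False e by (intro power_mono) auto
      then show ?thesis using e by (simp add: field_simps power_divide)
    qed
    finally show ?thesis by simp
  qed
  have "(\<integral>\<omega>. \<Phi> (hit_position \<omega>) \<partial>M) = \<Phi> 0 + 0 * of_real (2 * (\<integral>\<omega>. hit_time \<omega> \<partial>M))"
    by (rule hit_expectation[OF \<Phi> bound cont avg])
  also have "\<Phi> 0 = 0" using assms n by (auto simp: \<Phi>_def power_0_left)
  finally have zero: "(\<integral>\<omega>. \<Phi> (hit_position \<omega>) \<partial>M) = 0" by simp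
  obtain R m0 where A: "adapted R m0" by (rule adapted_exists)
  have ae: "AE \<omega> in M. disc_power n (hit_position \<omega>) ^ k = \<Phi> (hit_position \<omega>)"
    using AE_hit[OF A] by eventually_elim (use r in \<open>auto simp: \<Phi>_def slit_plane_eq[OF n]\<close>)
  note [measurable] = measurable_hit \<Phi>
  have "(\<integral>\<omega>. disc_power n (hit_position \<omega>) ^ k \<partial>M) = (\<integral>\<omega>. \<Phi> (hit_position \<omega>) \<partial>M)"
    by (intro integral_cong_AE ae) measurable
  with zero show ?thesis by simp
qed

text \<open>The truncated square is the test function with \<open>c = 1\<close>; it agrees with the
  true square at the hit position because the level set lies within radius \<open>R\<close>.\<close>

lemma hit_square: "(\<integral>\<omega>. (cmod (hit_position \<omega>))\<^sup>2 \<partial>M) = 2 * (\<integral>\<omega>. hit_time \<omega> \<partial>M)"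
proof -
  obtain R m0 where A: "adapted R m0" by (rule adapted_exists)
  define \<Phi> where "\<Phi> x = (if cmod x \<le> R + 1 then complex_of_real ((cmod x)\<^sup>2) else 0)" for x
  have \<Phi> [measurable]: "\<Phi> \<in> borel_measurable borel" unfolding \<Phi>_def [abs_def] by measurable
  note [measurable] = measurable_hit
  have bound: "cmod (\<Phi> x) \<le> (R + 1)\<^sup>2" for x
    by (auto simp: \<Phi>_def norm_power power_mono)
  have cont: "isCont \<Phi> x" if "cmod (disc_power n x) = r" for x
  proof -
    have x: "x \<in> {x. cmod x < R + 1}" using adaptedD(2)[OF A, of x] that by simp
    have op: "open {x :: complex. cmod x < R + 1}" by (intro open_Collect_less continuous_intros)
    have "continuous_on {x. cmod x < R + 1} (\<lambda>x. complex_of_real ((cmod x)\<^sup>2))" by (intro continuous_intros)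
    then have "continuous_on {x. cmod x < R + 1} \<Phi>" by (rule continuous_on_eq) (simp add: \<Phi>_def)
    then show ?thesis using x op by (simp add: continuous_on_eq_continuous_at)
  qed
  have avg: "cmod ((\<Phi> (x + y) + \<Phi> (x + \<i> * y) + \<Phi> (x - y) + \<Phi> (x - \<i> * y)) / 4 - \<Phi> x - 1 * of_real ((cmod y)\<^sup>2))
      \<le> ((R + 1)\<^sup>2 + 1) * cmod y ^ 4" if x: "cmod (disc_power n x) < r" for x y
    unfolding \<Phi>_def using adaptedD(2)[OF A, of x] x by (intro truncated_square_average) simp
  have "(\<integral>\<omega>. \<Phi> (hit_position \<omega>) \<partial>M) = \<Phi> 0 + 1 * of_real (2 * (\<integral>\<omega>. hit_time \<omega> \<partial>M))"
    by (rule hit_expectation[OF \<Phi> bound cont avg])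
  moreover have "(\<integral>\<omega>. \<Phi> (hit_position \<omega>) \<partial>M) = (\<integral>\<omega>. complex_of_real ((cmod (hit_position \<omega>))\<^sup>2) \<partial>M)"
  proof (intro integral_cong_AE)
    show "AE \<omega> in M. \<Phi> (hit_position \<omega>) = complex_of_real ((cmod (hit_position \<omega>))\<^sup>2)"
      using AE_hit[OF A]
    proof eventually_elim
      case (elim \<omega>)
      then show ?case using adaptedD(2)[OF A, of "hit_position \<omega>"] by (simp add: \<Phi>_def)
    qed
  qed measurable
  moreover have "\<Phi> 0 = 0" by (simp add: \<Phi>_def)
  ultimately have "complex_of_real (\<integral>\<omega>. (cmod (hit_position \<omega>))\<^sup>2 \<partial>M) = of_real (2 * (\<integral>\<omega>. hit_time \<omega> \<partial>M))"
    by (simp only: integral_complex_of_real) simp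
  then show ?thesis by (simp only: of_real_eq_iff)
qed

text \<open>By \<open>hit_square\<close> the expected time is half an expected squared modulus,
  which on the level \<open>r\<close> is \<open>(4 * r) powr a\<close> times the squared modulus of
  a binomial series in \<open>Y\<close>; Parseval evaluates its expectation.\<close>

lemma hit_time_series:
  fixes a defines "a \<equiv> 2 / real n"
  shows "(\<lambda>k. (4 * r) powr a / 2 * (((- a) gchoose k)\<^sup>2 * r ^ (2 * k))) sums (\<integral>\<omega>. hit_time \<omega> \<partial>M)"
proof -
  obtain R m0 where A: "adapted R m0" by (rule adapted_exists)
  note [measurable] = measurable_hit
  let ?Y = "\<lambda>\<omega>. disc_power n (hit_position \<omega>)"
  let ?F = "\<lambda>z. (1 + z) powr (- complex_of_real a)"
  have F: "(\<lambda>k. complex_of_real ((- a) gchoose k) * z ^ k) sums ?F z" if "cmod z < 1" for z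
  proof -
    have "(- complex_of_real a) gchoose k = complex_of_real ((- a) gchoose k)" for k
      by (simp add: gbinomial_prod_rev)
    then show ?thesis using gen_binomial_complex[OF that, of "- complex_of_real a"] by simp
  qed
  have mF [measurable]: "?F \<in> borel_measurable borel"
    unfolding powr_def by measurable
  have ae: "AE \<omega> in M. cmod (?Y \<omega>) = r"
    using AE_hit[OF A] by eventually_elim simp
  have "(\<lambda>k. ((- a) gchoose k)\<^sup>2 * r ^ (2 * k)) sums (\<integral>\<omega>. (cmod (?F (?Y \<omega>)))\<^sup>2 \<partial>M)"
    by (rule parseval_vanishing_moments[OF _ mF ae r hit_moments F]) measurable
  then have "(\<lambda>k. (4 * r) powr a / 2 * (((- a) gchoose k)\<^sup>2 * r ^ (2 * k))) sums ((4 * r) powr a / 2 * (\<integral>\<omega>. (cmod (?F (?Y \<omega>)))\<^sup>2 \<partial>M))"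
    by (rule sums_mult)
  also have "(4 * r) powr a / 2 * (\<integral>\<omega>. (cmod (?F (?Y \<omega>)))\<^sup>2 \<partial>M) = (\<integral>\<omega>. (4 * r) powr a * (cmod (?F (?Y \<omega>)))\<^sup>2 \<partial>M) / 2"
    by simp
  also have "(\<integral>\<omega>. (4 * r) powr a * (cmod (?F (?Y \<omega>)))\<^sup>2 \<partial>M) = (\<integral>\<omega>. (cmod (hit_position \<omega>))\<^sup>2 \<partial>M)"
  proof (rule integral_cong_AE)
    show "AE \<omega> in M. (4 * r) powr a * (cmod (?F (?Y \<omega>)))\<^sup>2 = (cmod (hit_position \<omega>))\<^sup>2"
      using ae
    proof eventually_elim
      case (elim \<omega>)
      show ?case using cmod_sq_disc_power[OF n, of "hit_position \<omega>"] elim by (simp add: a_def)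
    qed
  qed measurable
  finally show ?thesis by (simp add: hit_square)
qed

lemma passage_level:
  fixes a defines "a \<equiv> 2 / real n"
  shows "AE \<omega> in M. \<exists>T\<ge>0. path \<omega> T = r \<and> passage (path \<omega>) r = ennreal T"
    and "(\<integral>\<^sup>+\<omega>. passage (path \<omega>) r \<partial>M) = (\<Sum>k. ennreal ((4 * r) powr a / 2 * (((- a) gchoose k)\<^sup>2 * r ^ (2 * k))))"
proof -
  obtain R m0 where A: "adapted R m0" by (rule adapted_exists)
  show "AE \<omega> in M. \<exists>T\<ge>0. path \<omega> T = r \<and> passage (path \<omega>) r = ennreal T"
    using AE_hit[OF A] by eventually_elim blast
  have "(\<integral>\<^sup>+\<omega>. passage (path \<omega>) r \<partial>M) = (\<integral>\<^sup>+\<omega>. ennreal (hit_time \<omega>) \<partial>M)"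
    by (rule nn_integral_cong_AE) (use AE_hit[OF A] in \<open>eventually_elim, blast\<close>)
  also have "\<dots> = ennreal (\<integral>\<omega>. hit_time \<omega> \<partial>M)"
    by (rule nn_integral_eq_integral[OF hit_time_integral(1)[OF A]]) (use AE_hit[OF A] in \<open>eventually_elim, blast\<close>)
  also have "\<dots> = (\<Sum>k. ennreal ((4 * r) powr a / 2 * (((- a) gchoose k)\<^sup>2 * r ^ (2 * k))))"
    using hit_time_series r unfolding a_def by (intro suminf_ennreal_eq[symmetric]) auto
  finally show "(\<integral>\<^sup>+\<omega>. passage (path \<omega>) r \<partial>M) = (\<Sum>k. ennreal ((4 * r) powr a / 2 * (((- a) gchoose k)\<^sup>2 * r ^ (2 * k))))" .
qed

end

section \<open>Letting the level tend to 1\<close>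

theorem theorem1p12:
  fixes M :: "'a measure" and W :: "real \<Rightarrow> 'a \<Rightarrow> complex" and n :: nat
  assumes "planar_brownian_motion M W"
    and "n \<ge> 1"
  shows "(\<integral>\<^sup>+ \<omega>. exit_time W (slit_plane n) \<omega> \<partial>M) =
    (if n \<le> 4 then \<infinity>
     else ennreal (Gamma (1 / 2 - 2 / real n) / (2 * sqrt pi * Gamma (1 - 2 / real n))))"
proof -
  note W = assms(1) and n = assms(2)
  define a where "a = 2 / real n"
  define p where "p \<omega> t = cmod (disc_power n (W t \<omega> - W 0 \<omega>))" for \<omega> t
  \<comment> \<open>Levels increasing strictly below 1; the summand 2 makes the first one
    \<open>1 / 2\<close> and keeps all of them positive.\<close>
  define r where "r j = 1 - 1 / (real j + 2)" for j
  have r: "0 < r j" "r j < 1" for j by (auto simp: r_def field_simps)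
  have "(\<lambda>j. 1 - 1 / (real j + 2)) \<longlonglongrightarrow> 1" by real_asymp
  then have r_lim: "r \<longlonglongrightarrow> 1" by (simp add: r_def [abs_def])
  have r_inc: "incseq r" by (intro incseq_SucI) (auto simp: r_def intro!: divide_left_mono)
  interpret level_passage M W n "r j" for j
    using W n r by unfold_locales auto
  define f where "f j k = (4 * r j) powr a / 2 * (((- a) gchoose k)\<^sup>2 * r j ^ (2 * k))" for j k
  have X: "X t \<omega> = W t \<omega> - W 0 \<omega>" for t \<omega> by (rule X_def)
  have level: "AE \<omega> in M. \<exists>T\<ge>0. p \<omega> T = r j \<and> passage (p \<omega>) (r j) = ennreal T"
    "(\<integral>\<^sup>+\<omega>. passage (p \<omega>) (r j) \<partial>M) = (\<Sum>k. ennreal (f j k))" for j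
    using passage_level[of j] unfolding f_def a_def p_def [abs_def] X .
  have meas: "(\<lambda>\<omega>. passage (p \<omega>) (r j)) \<in> borel_measurable M" for j
  proof -
    have [measurable]: "W (real k * (1 / 2) ^ m) \<in> borel_measurable M" "W 0 \<in> borel_measurable M" for k m :: nat
      by (intro planar_brownian_motion_measurable[OF W]; simp)+
    show ?thesis unfolding passage_def p_def by measurable
  qed
  have "(\<integral>\<^sup>+\<omega>. exit_time W (slit_plane n) \<omega> \<partial>M) = (\<integral>\<^sup>+\<omega>. (SUP j. passage (p \<omega>) (r j)) \<partial>M)"
  proof (rule nn_integral_cong_AE)
    \<comment> \<open>There are countably many levels, so a single null set serves them all.\<close>
    have "AE \<omega> in M. \<forall>j. \<exists>T\<ge>0. p \<omega> T = r j \<and> passage (p \<omega>) (r j) = ennreal T"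
      unfolding AE_all_countable using level(1) by blast
    with planar_brownian_motion_continuous[OF W] planar_brownian_motion_start[OF W]
    show "AE \<omega> in M. exit_time W (slit_plane n) \<omega> = (SUP j. passage (p \<omega>) (r j))"
    proof eventually_elim
      case (elim \<omega>)
      have "continuous_on {0..} (p \<omega>)"
        unfolding p_def [abs_def] using elim(1)
        by (intro continuous_on_compose2[OF continuous_cmod_disc_power] continuous_intros) auto
      from SUP_passage[OF this r_inc r_lim r(2)] elim(3)
      have "(SUP j. passage (p \<omega>) (r j)) = (INF t\<in>{t. 0 \<le> t \<and> 1 \<le> p \<omega> t}. ennreal t)" by blast
      also have "\<dots> = exit_time W (slit_plane n) \<omega>"
        unfolding exit_time_def slit_plane_eq[OF n] p_def using elim(2) by (simp add: not_less)
      finally show ?case by simp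
    qed
  qed
  also have "\<dots> = (SUP j. \<integral>\<^sup>+\<omega>. passage (p \<omega>) (r j) \<partial>M)"
    using incseqD[OF r_inc]
    by (intro nn_integral_monotone_convergence_SUP meas) (auto simp: incseq_def le_fun_def intro!: passage_mono)
  also have "\<dots> = (SUP j. \<Sum>k. ennreal (f j k))" by (simp only: level(2))
  \<comment> \<open>Each term increases with the level, so supremum and sum commute even if the
    value is infinite.\<close>
  also have "\<dots> = (\<Sum>k. SUP j. ennreal (f j k))"
  proof (rule ennreal_suminf_SUP_eq[symmetric])
    show "incseq (\<lambda>j. ennreal (f j k))" for k
      unfolding incseq_def f_def using r(1) incseqD[OF r_inc] n
      by (auto intro!: ennreal_leI mult_mono divide_right_mono powr_mono2 power_mono simp: a_def less_imp_le)
  qed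
  also have "\<dots> = (\<Sum>k. ennreal (4 powr a / 2) * ennreal (((- a) gchoose k)\<^sup>2))"
  proof (intro suminf_cong)
    fix k
    have "incseq (\<lambda>j. ennreal (f j k))"
      unfolding incseq_def f_def using r(1) incseqD[OF r_inc] n
      by (auto intro!: ennreal_leI mult_mono divide_right_mono powr_mono2 power_mono simp: a_def less_imp_le)
    then have "(\<lambda>j. ennreal (f j k)) \<longlonglongrightarrow> (SUP j. ennreal (f j k))" by (rule LIMSEQ_SUP)
    moreover have "(\<lambda>j. f j k) \<longlonglongrightarrow> (4 * 1) powr a / 2 * (((- a) gchoose k)\<^sup>2 * 1 ^ (2 * k))"
      unfolding f_def by (intro tendsto_intros r_lim) auto
    then have "(\<lambda>j. ennreal (f j k)) \<longlonglongrightarrow> ennreal (4 powr a / 2 * ((- a) gchoose k)\<^sup>2)"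
      by (intro tendsto_ennrealI) simp
    ultimately show "(SUP j. ennreal (f j k)) = ennreal (4 powr a / 2) * ennreal (((- a) gchoose k)\<^sup>2)"
      using LIMSEQ_unique by (metis ennreal_mult' divide_nonneg_nonneg powr_ge_zero zero_le_numeral)
  qed
  also have "\<dots> = ennreal (4 powr a / 2) * (\<Sum>k. ennreal (((- a) gchoose k)\<^sup>2))" by simp
  also have "\<dots> = (if n \<le> 4 then \<infinity> else ennreal (Gamma (1 / 2 - 2 / real n) / (2 * sqrt pi * Gamma (1 - 2 / real n))))"
  proof (cases "n \<le> 4")
    case True
    \<comment> \<open>The threshold: \<open>2 / n \<ge> 1 / 2\<close> means
      \<open>n \<le> 4\<close>. The factor \<open>4 powr a / 2\<close> is positive, so the product
      stays infinite.\<close>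
    then have "a \<ge> 1 / 2" using n by (simp add: a_def field_simps)
    from suminf_gbinomial_sq_infinite[OF this] True show ?thesis by (simp add: ennreal_mult_top)
  next
    case False
    then have a: "0 < a" "a < 1 / 2" by (auto simp: a_def field_simps)
    have "ennreal (4 powr a / 2) * (\<Sum>k. ennreal (((- a) gchoose k)\<^sup>2)) =
        ennreal (4 powr a / 2 * (Gamma (1 - 2 * a) / (Gamma (1 - a))\<^sup>2))"
      unfolding suminf_gbinomial_sq[OF a] by (rule ennreal_mult'[symmetric]) simp
    then show ?thesis using False unfolding Gamma_value_rewrite[OF a] by (simp add: a_def)
  qed
  finally show ?thesis .
qed

end
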